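(* For every $d,n\in\mathbb N$ (positive integers), \[ D^*(n,d)\le 2.3463\sqrt{\frac dn}. \] Consequently, for every $d\in\mathbb N$ and $0<\varepsilon<1$, \[ n^*(d,\varepsilon)\le\left\lceil 5.5052\,d\,\varepsilon^{-2}\right\rceil . \]
   Context: For $\boldsymbol x\in[0,1]^d$ let $B_{\boldsymbol x}=\prod_{j=1}^d[0,x_j)$ and $V(\boldsymbol x)=\prod_{j=1}^d x_j$. For an $n$-point set $P\subset[0,1)^d$, the star discrepancy is \[ D_n^*(P)=\sup_{\boldsymbol x\in[0,1]^d}\left|\frac1n\sum_{\boldsymbol p\in P}\mathbf 1_{B_{\boldsymbol x}}(\boldsymbol p)-V(\boldsymbol x)\right| . \] $D^*(n,d):=\inf_{|P|=n}D_n^*(P)$, the infimum over $n$-point sets $P\subset[0,1)^d$, and, for $0<\varepsilon<1$, $n^*(d,\varepsilon):=\min\{n\in\mathbb N: D^*(n,d)\le\varepsilon\}$. *)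

theory Defs
  imports Complex_Main "HOL-Library.FuncSet" "HOL-Library.Indicator_Function"
begin

text \<open>
  A point of d-dimensional space is an extensional function on the index set \<open>{..<d}\<close>
  (value \<open>undefined\<close> outside of it), so that distinct elements of a point set are distinct
  vectors and \<open>card\<close> counts points correctly. Coordinates are numbered from 0 to d - 1.
\<close>

definition anchored_box :: "nat \<Rightarrow> (nat \<Rightarrow> real) \<Rightarrow> (nat \<Rightarrow> real) set" where
  "anchored_box d x = (\<Pi>\<^sub>E j\<in>{..<d}. {0..<x j})"

definition box_volume :: "nat \<Rightarrow> (nat \<Rightarrow> real) \<Rightarrow> real" where
  "box_volume d x = (\<Prod>j<d. x j)"

definition star_discrepancy :: "nat \<Rightarrow> (nat \<Rightarrow> real) set \<Rightarrow> real" where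
  "star_discrepancy d P =
     (SUP x \<in> {..<d} \<rightarrow>\<^sub>E {0..1}.
        \<bar>1 / real (card P) * (\<Sum>p\<in>P. indicator (anchored_box d x) p) - box_volume d x\<bar>)"

definition point_sets :: "nat \<Rightarrow> nat \<Rightarrow> (nat \<Rightarrow> real) set set" where
  "point_sets n d = {P. P \<subseteq> ({..<d} \<rightarrow>\<^sub>E {0..<1}) \<and> finite P \<and> card P = n}"

text \<open>
  For positive d and n the supremum above and the infimum below are taken over nonempty
  bounded sets of reals, so they are the true supremum and infimum.
\<close>

definition min_star_discrepancy :: "nat \<Rightarrow> nat \<Rightarrow> real" where
  "min_star_discrepancy n d = (INF P \<in> point_sets n d. star_discrepancy d P)"

definition inverse_star_discrepancy :: "nat \<Rightarrow> real \<Rightarrow> nat" where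
  "inverse_star_discrepancy d \<epsilon> = (LEAST n. 1 \<le> n \<and> min_star_discrepancy n d \<le> \<epsilon>)"

end

theory Submission
  imports Defs "HOL-Probability.Hoeffding" "HOL-Analysis.Harmonic_Numbers"
begin

text \<open>
  In dimension one, equispaced points have discrepancy at most \<open>1/n\<close>. For \<open>d \<ge> 2\<close> the proof combines
  \<open>n\<close> independent uniform points with a chaining argument over finite covers of the family of anchored
  boxes. Write \<open>\<sigma> = sqrt (d/n)\<close>; the goal is a point set of discrepancy at most \<open>2.3463 \<sigma>\<close>.

  Covers. A \<open>\<delta>\<close>-cover is a finite set \<open>\<Gamma>\<close> of corners such that every box of volume at least \<open>\<delta>\<close> lies between
  two boxes with corners in \<open>\<Gamma>\<close> whose volumes differ by at most \<open>\<delta>\<close>. In the coordinates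
  \<open>y\<^sub>j = - ln x\<^sub>j\<close> the volume is \<open>exp (- \<Sum>y\<^sub>j)\<close>, so rounding all \<open>y\<^sub>j\<close> to multiples of a step \<open>h\<close> changes
  the volume by a factor close to \<open>exp (- d h)\<close>. A box of volume \<open>V\<close> tolerates a relative error of \<open>\<delta>/V\<close>;
  hence small boxes may be rounded coarsely. Splitting the boxes into the dyadic layers
  \<open>2^-(i+1) < V \<le> 2^-i\<close>, each with its own step, gives a cover with at most \<open>(2/5) (3/\<delta>)^d\<close> elements
  (\<open>ex_bracketing_cover\<close>): layer \<open>i\<close> is a simplex of lattice points, and the factor \<open>d!\<close> saved in counting
  these cancels the \<open>d^d\<close> that comes from distributing the error over the \<open>d\<close> coordinates.

  Chaining. Take covers \<open>\<Gamma>\<^sub>0, ..., \<Gamma>\<^sub>K\<close> for decreasing precisions \<open>\<delta>\<^sub>0 > ... > \<delta>\<^sub>K\<close>. Every box of level \<open>k+1\<close>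
  is the disjoint union of a box of level \<open>k\<close> (or the empty box) and a remainder of volume at most \<open>\<delta>\<^sub>k\<close>. So it suffices to
  bound the deviation of the empirical measure on the boxes of level 0, where Hoeffding's inequality is
  used, and on the remainders, where the small variance makes the deviation much smaller. The
  discrepancy is then at most the sum of these deviations plus \<open>2 \<delta>\<^sub>K\<close> (\<open>min_star_discrepancy_chaining\<close>).

  Existence of the points. All deviation bounds are required at once for finitely many sets, by a union bound
  whose total is at most 1. Instead of arguing on the product space of all \<open>n\<close> points, the points are
  chosen one at a time so that a weighted sum of exponentials never increases
  (\<open>ex_point_set_small_weighted_product\<close>). This uses only the uniform distribution of a single point,
  and since single points are null sets, the chosen points can be kept distinct.

  Constants. The first level is very fine, \<open>\<delta>\<^sub>0 = 1/5000\<close>, and has the deviation \<open>2.2 \<sigma>\<close>; this is possible because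
  \<open>3/\<delta>\<^sub>0 = 15000 < exp (2 * 2.2^2)\<close>. The subsequent levels have \<open>\<delta>\<^sub>k = \<delta>\<^sub>0 / 100^k\<close> and the deviations
  \<open>0.1107 \<sigma> / 8^(k-1)\<close>, whose sum is at most \<open>0.1266 \<sigma>\<close>. The chain stops as soon as \<open>2 \<delta>\<^sub>K\<close> fits into
  what is left of \<open>2.3463 \<sigma>\<close>.
\<close>

section \<open>Point sets with simultaneously small deviations\<close>

text \<open>
  The method of conditional expectations: given the points chosen so far, the mean of the weighted sum over
  the next point does not exceed the current value, so some next point does not increase it. The atomlessness
  allows this point to avoid the previous ones, whence \<open>P\<close> really has \<open>n\<close> elements.
\<close>

lemma (in prob_space) ex_point_set_small_weighted_product:
  fixes f :: "'i \<Rightarrow> 'a \<Rightarrow> real" and w :: "'i \<Rightarrow> real"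
  assumes diffuse: "\<And>p. p \<in> space M \<Longrightarrow> AE x in M. x \<noteq> p"
    and int: "\<And>i. i \<in> A \<Longrightarrow> integrable M (f i)"
    and exp1: "\<And>i. i \<in> A \<Longrightarrow> expectation (f i) \<le> 1"
    and nonneg: "\<And>i x. i \<in> A \<Longrightarrow> 0 \<le> f i x" "\<And>i. i \<in> A \<Longrightarrow> 0 \<le> w i"
  shows "\<exists>P\<subseteq>space M. finite P \<and> card P = n \<and> (\<Sum>i\<in>A. w i * (\<Prod>p\<in>P. f i p)) \<le> sum w A"
proof (induction n)
  case 0
  show ?case by (intro exI[of _ "{}"]) simp
next
  case (Suc n)
  then obtain P where P: "P \<subseteq> space M" "finite P" "card P = n"
    and le: "(\<Sum>i\<in>A. w i * (\<Prod>p\<in>P. f i p)) \<le> sum w A" by blast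
  define c where "c i = w i * (\<Prod>p\<in>P. f i p)" for i
  define g where "g x = (\<Sum>i\<in>A. c i * f i x)" for x
  have c0: "0 \<le> c i" if "i \<in> A" for i
    unfolding c_def using nonneg that by (intro mult_nonneg_nonneg prod_nonneg) auto
  have int_g: "integrable M g"
    unfolding g_def using int by auto
  have "expectation g = (\<Sum>i\<in>A. c i * expectation (f i))"
    unfolding g_def using int by (subst Bochner_Integration.integral_sum) auto
  also have "\<dots> \<le> (\<Sum>i\<in>A. c i * 1)"
    using c0 exp1 by (intro sum_mono mult_left_mono) auto
  finally have exp_g: "expectation g \<le> sum w A" using le by (simp add: c_def)
  have "\<exists>x\<in>space M - P. g x \<le> sum w A"
  proof (rule ccontr)
    assume none: "\<not> ?thesis"
    have "AE x in M. \<forall>p\<in>P. x \<noteq> p"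
      using P diffuse by (intro AE_finite_allI) auto
    moreover have "AE x in M. x \<in> space M" by simp
    ultimately have "AE x in M. sum w A < g x"
      by eventually_elim (use none in force)
    from expectation_greater[OF int_g this] exp_g show False by simp
  qed
  then obtain x where x: "x \<in> space M" "x \<notin> P" "g x \<le> sum w A" by blast
  have "(\<Sum>i\<in>A. w i * (\<Prod>p\<in>insert x P. f i p)) = g x"
    unfolding g_def c_def using x P by (intro sum.cong) (auto simp: mult_ac)
  with x P show ?case by (intro exI[of _ "insert x P"]) auto
qed

lemma (in prob_space) expectation_exp_centred_indicator:
  assumes "E \<in> events"
  shows "expectation (\<lambda>x. exp (l * (indicator E x - prob E))) =
           exp (- l * prob E) * (1 + prob E * (exp l - 1))"
    and "integrable M (\<lambda>x. exp (l * (indicator E x - prob E)))"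
proof -
  have eq: "(\<lambda>x. exp (l * (indicator E x - prob E))) =
     (\<lambda>x. exp (- l * prob E) * (1 + (exp l - 1) * indicator E x))"
    by (auto simp: fun_eq_iff indicator_def exp_add[symmetric] algebra_simps)
  have [simp]: "integrable M (indicator E :: _ \<Rightarrow> real)"
    using assms by (simp add: emeasure_eq_measure)
  show "integrable M (\<lambda>x. exp (l * (indicator E x - prob E)))"
    unfolding eq by simp
  have "expectation (\<lambda>x. 1 + (exp l - 1) * indicator E x) = 1 + (exp l - 1) * prob E"
    using assms by (subst Bochner_Integration.integral_add) (auto simp: prob_space)
  then show "expectation (\<lambda>x. exp (l * (indicator E x - prob E))) =
           exp (- l * prob E) * (1 + prob E * (exp l - 1))"
    unfolding eq by (simp add: mult.commute)
qed

text \<open>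
  Hoeffding's lemma for one indicator. The scalar inequality behind it requires \<open>l \<ge> 0\<close>; a negative \<open>l\<close> is reduced to this case by
  passing to the complement of \<open>E\<close>.
\<close>

lemma (in prob_space) mgf_centred_indicator_le_Hoeffding:
  assumes "E \<in> events"
  shows "expectation (\<lambda>x. exp (l * (indicator E x - prob E))) \<le> exp (l\<^sup>2 / 8)"
proof -
  have *: "exp (- h * p) * (1 + p * (exp h - 1)) \<le> exp (h\<^sup>2 / 8)" if "h \<ge> 0" "p \<ge> 0" for h p :: real
  proof -
    have "0 < 1 + p * (exp h - 1)" using that by (intro add_pos_nonneg) auto
    then have "exp (- h * p) * (1 + p * (exp h - 1)) = exp (- h * p + ln (1 + p * (exp h - 1)))"
      using exp_add[of "- h * p" "ln (1 + p * (exp h - 1))"] by simp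
    also have "\<dots> \<le> exp (h\<^sup>2 / 8)"
      using Hoeffdings_lemma_aux[OF that] by simp
    finally show ?thesis .
  qed
  have "exp (- l * prob E) * (1 + prob E * (exp l - 1)) \<le> exp (l\<^sup>2 / 8)"
  proof (cases "l \<ge> 0")
    case True
    then show ?thesis using *[of l "prob E"] by simp
  next
    case False
    have "exp (- l * prob E) * (1 + prob E * (exp l - 1)) =
       exp (- (-l) * (1 - prob E)) * (1 + (1 - prob E) * (exp (-l) - 1))"
      by (simp add: algebra_simps exp_diff exp_minus exp_add field_simps)
    then show ?thesis using *[of "-l" "1 - prob E"] False by simp
  qed
  then show ?thesis using expectation_exp_centred_indicator(1)[OF assms] by simp
qed

lemma exp_le_quadratic:
  fixes x :: real
  assumes "\<bar>x\<bar> \<le> 1"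
  shows "exp x \<le> 1 + x + x\<^sup>2"
proof (cases "x \<ge> 0")
  case True
  then show ?thesis using assms exp_bound by auto
next
  case False
  define y where "y = - x"
  have y: "0 \<le> y" "y \<le> 1" using False assms by (auto simp: y_def)
  have pos: "0 < 1 - y + y\<^sup>2"
    using y by (cases "y = 1") (auto intro: add_pos_nonneg)
  have "1 \<le> (1 - y + y\<^sup>2) * (1 + y + y\<^sup>2 / 2)"
  proof -
    have "(1 - y + y\<^sup>2) * (1 + y + y\<^sup>2 / 2) = 1 + y\<^sup>2 / 2 * (1 + y + y\<^sup>2)"
      by (simp add: field_simps power2_eq_square)
    then show ?thesis using y by simp
  qed
  also have "\<dots> \<le> (1 - y + y\<^sup>2) * exp y"
    using pos y exp_lower_Taylor_quadratic[of y] by (intro mult_left_mono) auto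
  finally show ?thesis
    using pos by (simp add: y_def exp_minus field_simps)
qed

text \<open>
  For sets of small probability the variance, rather than the range, governs the moment generating function; this is
  what makes the later levels of the chain cheap. The restriction to \<open>\<bar>l\<bar> \<le> 1\<close> keeps the third order terms under control.
\<close>

lemma (in prob_space) mgf_centred_indicator_le_small:
  assumes "E \<in> events" "prob E \<le> \<delta>" "\<bar>l\<bar> \<le> 1"
  shows "expectation (\<lambda>x. exp (l * (indicator E x - prob E))) \<le> exp (\<delta> * l\<^sup>2)"
proof -
  have "exp (- l * prob E) * (1 + prob E * (exp l - 1)) \<le>
        exp (- l * prob E) * exp (prob E * (exp l - 1))"
    using exp_ge_add_one_self by (intro mult_left_mono) auto
  also have "\<dots> = exp (prob E * (exp l - 1 - l))"
    by (simp add: exp_add[symmetric] algebra_simps)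
  also have "\<dots> \<le> exp (\<delta> * l\<^sup>2)"
    using exp_le_quadratic[OF assms(3)] exp_ge_add_one_self[of l] order_trans[OF measure_nonneg assms(2)]
    by (auto intro!: mult_mono assms(2) simp del: exp_ge_add_one_self)
  finally show ?thesis using expectation_exp_centred_indicator(1)[OF assms(1)] by simp
qed

text \<open>
  A Chernoff bound for finitely many events at once, in both directions. The sum in the last assumption
  is the union bound for the probability that some deviation exceeds its threshold.
\<close>

lemma (in prob_space) ex_point_set_simultaneous_deviation:
  fixes E :: "'i \<Rightarrow> 'a set" and l \<psi> t :: "'i \<Rightarrow> real"
  assumes diffuse: "\<And>p. p \<in> space M \<Longrightarrow> AE x in M. x \<noteq> p"
    and fin: "finite A" and ev: "\<And>i. i \<in> A \<Longrightarrow> E i \<in> events"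
    and l: "\<And>i. i \<in> A \<Longrightarrow> 0 < l i"
    and mgf: "\<And>i s. i \<in> A \<Longrightarrow> s \<in> {1, -1} \<Longrightarrow>
        expectation (\<lambda>x. exp (s * l i * (indicator (E i) x - prob (E i)))) \<le> exp (\<psi> i)"
    and n: "1 \<le> n"
    and total: "(\<Sum>i\<in>A. 2 * exp (real n * (\<psi> i - l i * t i))) \<le> 1"
  shows "\<exists>P\<subseteq>space M. finite P \<and> card P = n \<and>
           (\<forall>i\<in>A. \<bar>(\<Sum>p\<in>P. indicator (E i) p) / real n - prob (E i)\<bar> \<le> t i)"
proof -
  \<comment> \<open>each event occurs twice, the sign \<open>s\<close> selecting the upper or the lower deviation\<close>
  define f where "f = (\<lambda>(i, s) x. exp (s * l i * (indicator (E i) x - prob (E i)) - \<psi> i))"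
  \<comment> \<open>with these weights, a single summand at most 1 already means a deviation at most \<open>t i\<close>\<close>
  define w where "w = (\<lambda>(i, s::real). exp (real n * (\<psi> i - l i * t i)))"
  define B where "B = A \<times> {1, -1::real}"
  have f_eq: "f (i, s) = (\<lambda>x. exp (s * l i * (indicator (E i) x - prob (E i))) * exp (- \<psi> i))" for i s
    by (simp add: f_def exp_add[symmetric] algebra_simps)
  have "\<exists>P\<subseteq>space M. finite P \<and> card P = n \<and> (\<Sum>b\<in>B. w b * (\<Prod>p\<in>P. f b p)) \<le> sum w B"
  proof (rule ex_point_set_small_weighted_product[OF diffuse])
    fix b assume "b \<in> B"
    then obtain i s where b: "b = (i, s)" and i: "i \<in> A" and s: "s \<in> {1, -1}" by (auto simp: B_def)
    show "integrable M (f b)"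
      unfolding b f_eq using expectation_exp_centred_indicator(2)[OF ev[OF i]] by auto
    show "expectation (f b) \<le> 1"
      unfolding b f_eq using mgf[OF i s] by (simp add: exp_minus field_simps)
    show "0 \<le> f b x" for x by (simp add: b f_eq)
    show "0 \<le> w b" by (simp add: b w_def)
  qed
  then obtain P where P: "P \<subseteq> space M" "finite P" "card P = n"
    and le: "(\<Sum>b\<in>B. w b * (\<Prod>p\<in>P. f b p)) \<le> sum w B" by blast
  have "sum w B = (\<Sum>i\<in>A. 2 * exp (real n * (\<psi> i - l i * t i)))"
    unfolding B_def w_def sum.cartesian_product[symmetric] by simp
  then have W: "sum w B \<le> 1" using total by simp
  have finB: "finite B" using fin by (simp add: B_def)
  have dev: "s * ((\<Sum>p\<in>P. indicator (E i) p) / real n - prob (E i)) \<le> t i"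
    if i: "i \<in> A" and s: "s \<in> {1, -1}" for i s
  proof -
    define S :: real where "S = (\<Sum>p\<in>P. indicator (E i) p)"
    have "(\<Prod>p\<in>P. f (i, s) p) = exp (\<Sum>p\<in>P. s * l i * (indicator (E i) p - prob (E i)) - \<psi> i)"
      unfolding f_def using P by (simp add: exp_sum)
    also have "(\<Sum>p\<in>P. s * l i * (indicator (E i) p - prob (E i)) - \<psi> i) =
        s * l i * (S - real n * prob (E i)) - real n * \<psi> i"
      unfolding S_def using P by (simp add: sum_subtractf sum_distrib_left[symmetric])
    finally have eq: "w (i, s) * (\<Prod>p\<in>P. f (i, s) p) = exp (l i * (s * (S - real n * prob (E i)) - real n * t i))"
      by (simp add: w_def exp_add[symmetric] algebra_simps)
    have "w (i, s) * (\<Prod>p\<in>P. f (i, s) p) \<le> (\<Sum>b\<in>B. w b * (\<Prod>p\<in>P. f b p))"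
      using finB i s by (intro member_le_sum) (auto simp: B_def w_def f_def intro!: mult_nonneg_nonneg prod_nonneg)
    with le W have "w (i, s) * (\<Prod>p\<in>P. f (i, s) p) \<le> 1" by linarith
    then have "l i * (s * (S - real n * prob (E i)) - real n * t i) \<le> 0"
      unfolding eq by simp
    then have "s * (S - real n * prob (E i)) \<le> real n * t i"
      using l[OF i] by (simp add: mult_le_0_iff)
    then have "s * (S - real n * prob (E i)) / real n \<le> t i"
      using n by (simp add: divide_le_eq mult.commute)
    moreover have "s * (S - real n * prob (E i)) / real n = s * (S / real n - prob (E i))"
      using n by (simp add: field_simps)
    ultimately show ?thesis by (simp add: S_def)
  qed
  have "\<forall>i\<in>A. \<bar>(\<Sum>p\<in>P. indicator (E i) p) / real n - prob (E i)\<bar> \<le> t i"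
    using dev[of _ 1] dev[of _ "-1"] by (auto simp: abs_le_iff)
  with P show ?thesis by blast
qed

section \<open>The uniform distribution on the cube\<close>

text \<open>
  Restricting Lebesgue measure to the unit interval, instead of conditioning on it, makes the space of this measure
  exactly the set from which the points of a point set are taken.
\<close>

definition uniform_cube :: "nat \<Rightarrow> (nat \<Rightarrow> real) measure" where
  "uniform_cube d = PiM {..<d} (\<lambda>_. restrict_space lborel {0..<1})"

lemma prob_space_uniform_interval: "prob_space (restrict_space lborel {0..<1::real})"
  by (rule prob_space_restrict_space) auto

lemma product_prob_space_uniform_interval:
  "product_prob_space (\<lambda>_::nat. restrict_space lborel {0..<1::real})"
  by (intro product_prob_spaceI prob_space_uniform_interval)

lemma prob_space_uniform_cube: "prob_space (uniform_cube d)"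
  unfolding uniform_cube_def by (intro prob_space_PiM prob_space_uniform_interval)

lemma space_uniform_cube: "space (uniform_cube d) = {..<d} \<rightarrow>\<^sub>E {0..<1}"
  by (simp add: uniform_cube_def space_PiM space_restrict_space)

lemma anchored_box_in_sets_uniform_cube:
  assumes "x \<in> {..<d} \<rightarrow>\<^sub>E {0..1}"
  shows "anchored_box d x \<in> sets (uniform_cube d)"
  unfolding anchored_box_def uniform_cube_def
  using assms by (intro sets_PiM_I_finite) (auto simp: sets_restrict_space_iff PiE_iff)

lemma measure_anchored_box:
  assumes "x \<in> {..<d} \<rightarrow>\<^sub>E {0..1}"
  shows "measure (uniform_cube d) (anchored_box d x) = box_volume d x"
proof -
  interpret product_prob_space "\<lambda>_::nat. restrict_space lborel {0..<1::real}"
    by (rule product_prob_space_uniform_interval)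
  have "emeasure (uniform_cube d) (anchored_box d x) =
      (\<Prod>j<d. emeasure (restrict_space lborel {0..<1::real}) {0..<x j})"
    unfolding anchored_box_def uniform_cube_def
    using assms by (intro emeasure_PiM) (auto simp: sets_restrict_space_iff PiE_iff)
  also have "\<dots> = (\<Prod>j<d. ennreal (x j))"
    using assms by (intro prod.cong refl, subst emeasure_restrict_space) (auto simp: PiE_iff)
  also have "\<dots> = ennreal (box_volume d x)"
    unfolding box_volume_def using assms by (intro prod_ennreal) (auto simp: PiE_iff)
  finally show ?thesis
    using assms by (auto simp: measure_def box_volume_def PiE_iff intro!: enn2real_ennreal prod_nonneg)
qed

lemma AE_uniform_cube_neq:
  assumes "1 \<le> d" and p: "p \<in> space (uniform_cube d)"
  shows "AE x in uniform_cube d. x \<noteq> p"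
proof -
  interpret product_prob_space "\<lambda>_::nat. restrict_space lborel {0..<1::real}"
    by (rule product_prob_space_uniform_interval)
  have p': "p \<in> {..<d} \<rightarrow>\<^sub>E {0..<1}" using p by (simp add: space_uniform_cube)
  have sing: "{p} = (\<Pi>\<^sub>E j\<in>{..<d}. {p j})"
    using PiE_singleton[of p "{..<d}"] p' by (auto simp: PiE_iff)
  have sets: "(\<Pi>\<^sub>E j\<in>{..<d}. {p j}) \<in> sets (uniform_cube d)"
    unfolding uniform_cube_def
    using p' by (intro sets_PiM_I_finite) (auto simp: sets_restrict_space_iff PiE_iff)
  have "emeasure (uniform_cube d) (\<Pi>\<^sub>E j\<in>{..<d}. {p j}) =
      (\<Prod>j<d. emeasure (restrict_space lborel {0..<1::real}) {p j})"
    unfolding uniform_cube_def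
    using p' by (intro emeasure_PiM) (auto simp: sets_restrict_space_iff PiE_iff)
  also have "\<dots> = (\<Prod>j<d. 0)"
    using p' by (intro prod.cong refl, subst emeasure_restrict_space) (auto simp: PiE_iff)
  also have "\<dots> = 0" using assms by simp
  finally have "{p} \<in> null_sets (uniform_cube d)"
    using sets unfolding sing by (simp add: null_sets_def)
  from AE_not_in[OF this] show ?thesis by simp
qed

section \<open>Bracketing covers of the anchored boxes\<close>

text \<open>
  In logarithmic coordinates these are the points of the lattice of step \<open>h\<close> in a simplex.
\<close>

definition exp_lattice :: "nat \<Rightarrow> real \<Rightarrow> nat \<Rightarrow> (nat \<Rightarrow> real) set" where
  "exp_lattice d h N = (\<lambda>m. \<lambda>j\<in>{..<d}. exp (- h * real (m j))) ` {m. (\<Sum>j<d. m j) \<le> N}"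

lemma finite_exp_lattice_card:
  shows "finite (exp_lattice d h N)" and "card (exp_lattice d h N) \<le> (N + d) choose d"
proof -
  define L where "L = {l::nat list. size l = Suc d \<and> sum_list l = N}"
  have finL: "finite L"
  proof (rule finite_subset)
    show "L \<subseteq> {l. set l \<subseteq> {..N} \<and> length l = Suc d}"
      unfolding L_def by (auto simp: member_le_sum_list)
  qed (auto intro: finite_lists_length_eq)
  define F where "F l = (\<lambda>j\<in>{..<d}. exp (- h * real (l ! j)))" for l :: "nat list"
  have sub: "exp_lattice d h N \<subseteq> F ` L"
  proof
    fix v assume "v \<in> exp_lattice d h N"
    then obtain m where m: "(\<Sum>j<d. m j) \<le> N" and v: "v = (\<lambda>j\<in>{..<d}. exp (- h * real (m j)))"
      by (auto simp: exp_lattice_def)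
    \<comment> \<open>the last entry of the list takes up the slack\<close>
    define l where "l = map m [0..<d] @ [N - (\<Sum>j<d. m j)]"
    have "sum_list l = N" using m by (simp add: l_def interv_sum_list_conv_sum_set_nat atLeast0LessThan)
    then have "l \<in> L" by (simp add: L_def l_def)
    moreover have "v = F l"
      unfolding v F_def by (intro restrict_ext) (simp add: l_def nth_append)
    ultimately show "v \<in> F ` L" by blast
  qed
  show "finite (exp_lattice d h N)" using sub finL by (meson finite_imageI finite_subset)
  have "card (exp_lattice d h N) \<le> card (F ` L)"
    using sub finL by (intro card_mono) auto
  also have "\<dots> \<le> card L" using finL by (rule card_image_le)
  also have "\<dots> = (N + d) choose N"
    unfolding L_def card_length_sum_list by simp
  also have "\<dots> = (N + d) choose d" by (simp add: binomial_symmetric[of N "N + d"])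
  finally show "card (exp_lattice d h N) \<le> (N + d) choose d" .
qed

lemma exp_lattice_subset:
  assumes "0 \<le> h"
  shows "exp_lattice d h N \<subseteq> {..<d} \<rightarrow>\<^sub>E {0..1}"
  using assms by (auto simp: exp_lattice_def PiE_iff split: if_splits)

text \<open>
  The consequence of Stirling's formula that is needed: \<open>d^d / d!\<close> grows by a factor \<open>(1 + 1/d)^d \<le> e\<close> in each step.
\<close>

lemma power_self_le_fact:
  assumes "2 \<le> d"
  shows "real d ^ d \<le> 2 * 3 ^ (d - 2) * fact d"
  using assms
proof (induction d rule: dec_induct)
  case base
  show ?case by (simp add: fact_numeral power2_eq_square)
next
  case (step d)
  have "(1 + 1 / real d) ^ d \<le> exp 1"
    using exp_ge_one_plus_x_over_n_power_n[of d 1] step.hyps by simp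
  also have "\<dots> \<le> (3::real)" by (rule exp_le)
  finally have e: "(1 + 1 / real d) ^ d \<le> 3" .
  have "real (Suc d) ^ Suc d = real (Suc d) * ((1 + 1 / real d) ^ d * real d ^ d)"
    using step.hyps by (simp add: power_mult_distrib[symmetric] field_simps)
  also have "\<dots> \<le> real (Suc d) * (3 * (2 * 3 ^ (d - 2) * fact d))"
    using step.IH e by (intro mult_left_mono mult_mono) auto
  also have "\<dots> = 2 * 3 ^ (Suc d - 2) * fact (Suc d)"
    using step.hyps(1) by (simp add: Suc_diff_le flip: power_Suc)
  finally show ?case .
qed

text \<open>
  The two series occurring in the size of the cover are summed by exhibiting the remainder in closed form.
\<close>

lemma sum_squares_over_four_power:
  "(\<Sum>i<m. (real i + 1)\<^sup>2 / 4 ^ i) \<le> 80/27"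
proof -
  have "(\<Sum>i<m. (real i + 1)\<^sup>2 / 4 ^ i) = 80/27 - (4/3 * (real m)\<^sup>2 + 32/9 * real m + 80/27) / 4 ^ m"
  proof (induction m)
    case (Suc m)
    show ?case
      unfolding sum.lessThan_Suc Suc.IH by (simp add: field_simps power2_eq_square)
  qed simp
  moreover have "0 \<le> (4/3 * (real m)\<^sup>2 + 32/9 * real m + 80/27) / 4 ^ m" by simp
  ultimately show ?thesis by linarith
qed

lemma sum_squares_over_two_power:
  "(\<Sum>i<m. (real i + 1)\<^sup>2 / 2 ^ i) \<le> 12"
proof -
  have "(\<Sum>i<m. (real i + 1)\<^sup>2 / 2 ^ i) = 12 - (2 * (real m)\<^sup>2 + 8 * real m + 12) / 2 ^ m"
  proof (induction m)
    case (Suc m)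
    show ?case
      unfolding sum.lessThan_Suc Suc.IH by (simp add: field_simps power2_eq_square)
  qed simp
  moreover have "0 \<le> (2 * (real m)\<^sup>2 + 8 * real m + 12) / 2 ^ m" by simp
  ultimately show ?thesis by linarith
qed

lemma Suc_square_le_two_power: "(i + 1)\<^sup>2 \<le> 3 * (2::nat) ^ i"
proof (cases "i \<le> 2")
  case True
  then have "i = 0 \<or> i = 1 \<or> i = 2" by auto
  then show ?thesis by (auto simp: power2_eq_square)
next
  case False
  then have "3 \<le> i" by simp
  then show ?thesis
  proof (induction i rule: dec_induct)
    case (step i)
    have "3 * 3 \<le> i * i" using step.hyps by (intro mult_le_mono) auto
    then have "(Suc i + 1)\<^sup>2 \<le> 2 * (i + 1)\<^sup>2" using step.hyps by (simp add: power2_eq_square algebra_simps)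
    with step.IH show ?case by simp
  qed (simp add: power2_eq_square)
qed

text \<open>
  The cover for layer \<open>i\<close> consists of at most \<open>N + d choose d\<close> lattice points, where \<open>N + d\<close> is at most
  \<open>d/\<delta>\<close> times this number. The leading term is \<open>(i + 1) ln 2 / 2^i\<close>; the terms with \<open>\<delta>\<close> are rounding errors.
\<close>

definition layer_count :: "real \<Rightarrow> nat \<Rightarrow> real" where
  "layer_count \<delta> i = real (i + 1) * ln 2 * (1 / 2 ^ i + \<delta>) + 2 * \<delta>"

text \<open>
  The square is bounded by separating the leading term \<open>x\<close> from the rounding error \<open>e\<close>. For the latter, one factor
  \<open>\<delta>\<close> is bounded by \<open>1/5000\<close> and the other by \<open>1/2^i\<close>, which makes the errors summable over all layers.
\<close>

lemma layer_count_bounds: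
  assumes "0 < \<delta>" "\<delta> \<le> 1/5000" "2 ^ i * \<delta> \<le> 1"
  shows "0 \<le> layer_count \<delta> i" "layer_count \<delta> i \<le> 1"
    and "(layer_count \<delta> i)\<^sup>2 \<le> 0.539 * ((real i + 1)\<^sup>2 / 4 ^ i) + 0.016038 * ((real i + 1)\<^sup>2 / 2 ^ i)"
proof -
  define x where "x = 0.7 * (real i + 1) / 2 ^ i"
  define e where "e = \<delta> * (2.7 * (real i + 1))"
  have ln2: "0 \<le> ln (2::real)" "ln (2::real) \<le> 0.7" using ln2_le_25_over_36 by auto
  show nn: "0 \<le> layer_count \<delta> i"
    unfolding layer_count_def using assms ln2 by (intro add_nonneg_nonneg mult_nonneg_nonneg) auto
  have "layer_count \<delta> i \<le> (real i + 1) * 0.7 * (1 / 2 ^ i + \<delta>) + 2 * \<delta> * (real i + 1)"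
  proof -
    have "2 * \<delta> * 1 \<le> 2 * \<delta> * (real i + 1)" using assms by (intro mult_left_mono) auto
    moreover have "real (i + 1) * ln 2 * (1 / 2 ^ i + \<delta>) \<le> (real i + 1) * 0.7 * (1 / 2 ^ i + \<delta>)"
      using assms ln2 by (intro mult_mono) auto
    ultimately show ?thesis unfolding layer_count_def by linarith
  qed
  also have "\<dots> = x + e" by (simp add: x_def e_def field_simps)
  finally have le: "layer_count \<delta> i \<le> x + e" .
  have x0: "0 \<le> x" and e0: "0 \<le> e" using assms by (auto simp: x_def e_def)
  have d2: "\<delta>\<^sup>2 \<le> 1/5000 * (1 / 2 ^ i)"
    unfolding power2_eq_square using assms by (intro mult_mono) (auto simp: field_simps)
  have "e\<^sup>2 = \<delta>\<^sup>2 * (7.29 * (real i + 1)\<^sup>2)" by (simp add: e_def power2_eq_square field_simps)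
  also have "\<dots> \<le> 1/5000 * (1 / 2 ^ i) * (7.29 * (real i + 1)\<^sup>2)"
    using d2 by (intro mult_right_mono) auto
  finally have e2: "e\<^sup>2 \<le> 7.29/5000 * ((real i + 1)\<^sup>2 / 2 ^ i)" by simp
  have sq: "(real i + 1)\<^sup>2 \<le> 3 * 2 ^ i"
  proof -
    have "real ((i + 1)\<^sup>2) \<le> real (3 * 2 ^ i)" using Suc_square_le_two_power of_nat_le_iff by blast
    then show ?thesis by (simp add: add.commute)
  qed
  have "x \<le> 0.7"
  proof -
    have "i + 1 \<le> 2 ^ i" using less_exp[of i] by linarith
    then have "real (i + 1) \<le> real (2 ^ i)" using of_nat_le_iff by blast
    then show ?thesis by (simp add: x_def field_simps)
  qed
  moreover have "e \<le> 0.3"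
  proof (rule power2_le_imp_le)
    have "(real i + 1)\<^sup>2 / 2 ^ i \<le> 3" using sq by (simp add: field_simps)
    then show "e\<^sup>2 \<le> 0.3\<^sup>2" using e2 by (simp add: power2_eq_square)
  qed simp
  ultimately show "layer_count \<delta> i \<le> 1" using le by simp
  have "(layer_count \<delta> i)\<^sup>2 \<le> (x + e)\<^sup>2" using le nn by (intro power_mono)
  also have "\<dots> \<le> 1.1 * x\<^sup>2 + 11 * e\<^sup>2"
  proof -
    have "0 \<le> (x - 10 * e)\<^sup>2" by simp
    then show ?thesis by (simp add: power2_eq_square algebra_simps)
  qed
  also have "x\<^sup>2 = 0.49 * ((real i + 1)\<^sup>2 / 4 ^ i)"
  proof -
    have "(4::real) ^ i = (2 ^ i)\<^sup>2" by (simp add: power_mult[symmetric] mult.commute[of i] power_mult)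
    then show ?thesis by (simp add: x_def power2_eq_square algebra_simps)
  qed
  also have "1.1 * (0.49 * ((real i + 1)\<^sup>2 / 4 ^ i)) + 11 * e\<^sup>2 \<le>
      1.1 * (0.49 * ((real i + 1)\<^sup>2 / 4 ^ i)) + 11 * (7.29/5000 * ((real i + 1)\<^sup>2 / 2 ^ i))"
    using e2 by (intro add_left_mono mult_left_mono) auto
  finally show "(layer_count \<delta> i)\<^sup>2 \<le> 0.539 * ((real i + 1)\<^sup>2 / 4 ^ i) + 0.016038 * ((real i + 1)\<^sup>2 / 2 ^ i)"
    by simp
qed

lemma sum_layer_count_squares:
  assumes "0 < \<delta>" "\<delta> \<le> 1/5000" "I \<subseteq> {i. 2 ^ i * \<delta> \<le> 1}" "finite I"
  shows "(\<Sum>i\<in>I. (layer_count \<delta> i)\<^sup>2) \<le> 1.8"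
proof -
  obtain m where m: "I \<subseteq> {..<m}" using assms(4) finite_nat_iff_bounded by blast
  have "(\<Sum>i\<in>I. (layer_count \<delta> i)\<^sup>2) \<le> (\<Sum>i\<in>I. 0.539 * ((real i + 1)\<^sup>2 / 4 ^ i) + 0.016038 * ((real i + 1)\<^sup>2 / 2 ^ i))"
    using assms by (intro sum_mono layer_count_bounds) auto
  also have "\<dots> \<le> (\<Sum>i<m. 0.539 * ((real i + 1)\<^sup>2 / 4 ^ i) + 0.016038 * ((real i + 1)\<^sup>2 / 2 ^ i))"
    using m by (intro sum_mono2) auto
  also have "\<dots> = 0.539 * (\<Sum>i<m. (real i + 1)\<^sup>2 / 4 ^ i) + 0.016038 * (\<Sum>i<m. (real i + 1)\<^sup>2 / 2 ^ i)"
    by (simp add: sum.distrib sum_distrib_left)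
  also have "\<dots> \<le> 1.8"
    using sum_squares_over_four_power[of m] sum_squares_over_two_power[of m] by simp
  finally show ?thesis .
qed

lemma ex_dyadic_layer:
  fixes V :: real
  assumes "0 < V" "V \<le> 1"
  shows "\<exists>i. V \<le> 1 / 2 ^ i \<and> 1 / 2 ^ (i + 1) < V"
proof -
  obtain n where n: "1 / V < 2 ^ n" using real_arch_pow[of 2 "1/V"] by auto
  define k where "k = (LEAST n. 1 / V < 2 ^ n)"
  have k: "1 / V < 2 ^ k" unfolding k_def using n by (rule LeastI)
  have "k \<noteq> 0" using k assms by (intro notI) (simp add: field_simps)
  then obtain i where i: "k = Suc i" using not0_implies_Suc by blast
  have "\<not> 1 / V < 2 ^ i" using not_less_Least[of i "\<lambda>n. 1 / V < 2 ^ n"] i by (auto simp: k_def[symmetric])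
  then show ?thesis using k i assms by (intro exI[of _ i]) (auto simp: field_simps)
qed

text \<open>
  A box is bracketed by rounding its logarithmic coordinates down and up to multiples of \<open>h\<close>. The step is
  chosen such that \<open>exp (h * d) \<le> 1 + u\<close> while \<open>1/h\<close> remains a simple rational expression. The point rounded up has one more
  step in each coordinate than the one rounded down, hence the summand \<open>d\<close> in \<open>N\<close>.
\<close>

lemma exp_lattice_brackets_layer:
  assumes d: "1 \<le> d" and u: "0 < u" and x: "x \<in> {..<d} \<rightarrow>\<^sub>E {0..1}"
    and V: "1 / 2 ^ (i + 1) < box_volume d x"
    and h: "h = u / ((1 + u) * real d)"
    and N: "N = nat \<lfloor>real (i + 1) * ln 2 / h\<rfloor> + d"
  shows "\<exists>v\<in>exp_lattice d h N. \<exists>w\<in>exp_lattice d h N. (\<forall>j<d. v j \<le> x j \<and> x j \<le> w j) \<and>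
           box_volume d w - box_volume d v \<le> u * box_volume d x"
proof -
  have h0: "0 < h" using d u by (simp add: h)
  have Vpos: "0 < box_volume d x" using V by (meson less_trans zero_less_divide_1_iff zero_less_numeral zero_less_power)
  have xpos: "0 < x j" if "j < d" for j
  proof (rule ccontr)
    assume "\<not> 0 < x j"
    then have "x j = 0" using x that by (force simp: PiE_iff)
    then have "box_volume d x = 0" using that by (auto simp: box_volume_def)
    with Vpos show False by simp
  qed
  define y where "y j = - ln (x j)" for j
  have xy: "x j = exp (- y j)" if "j < d" for j using xpos[OF that] by (simp add: y_def)
  have y0: "0 \<le> y j" if "j < d" for j using x xpos that by (auto simp: y_def PiE_iff)
  define m where "m j = nat \<lfloor>y j / h\<rfloor>" for j
  have mle: "h * real (m j) \<le> y j" and mgt: "y j \<le> h * real (m j + 1)" if "j < d" for j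
  proof -
    have "0 \<le> y j / h" using y0[OF that] h0 by simp
    then have "real (m j) \<le> y j / h" "y j / h \<le> real (m j) + 1"
      unfolding m_def by linarith+
    then show "h * real (m j) \<le> y j" "y j \<le> h * real (m j + 1)"
      using h0 by (auto simp: field_simps)
  qed
  have sumy: "(\<Sum>j<d. y j) \<le> real (i + 1) * ln 2"
  proof -
    have "(\<Sum>j<d. y j) = - ln (box_volume d x)"
      unfolding box_volume_def y_def using xpos by (subst ln_prod) (fastforce simp: sum_negf)+
    also have "\<dots> \<le> - ln (1 / 2 ^ (i + 1))" using V Vpos by simp
    also have "\<dots> = real (i + 1) * ln 2" by (simp add: ln_div ln_realpow del: power_Suc)
    finally show ?thesis .
  qed
  have "h * real (\<Sum>j<d. m j) \<le> (\<Sum>j<d. y j)"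
    unfolding of_nat_sum sum_distrib_left using mle by (intro sum_mono) auto
  then have "real (\<Sum>j<d. m j) \<le> real (i + 1) * ln 2 / h"
    using sumy h0 by (simp add: field_simps)
  then have summ: "(\<Sum>j<d. m j) + d \<le> N"
    unfolding N by linarith
  define w where "w = (\<lambda>j\<in>{..<d}. exp (- h * real (m j)))"
  define v where "v = (\<lambda>j\<in>{..<d}. exp (- h * real (m j + 1)))"
  have "w \<in> exp_lattice d h N"
    unfolding w_def exp_lattice_def using summ by (intro imageI) simp
  moreover have "v \<in> exp_lattice d h N"
    unfolding v_def exp_lattice_def using summ by (intro imageI) (simp add: sum_Suc)
  moreover have vx: "v j \<le> x j" and xw: "x j \<le> w j" if "j < d" for j
    using mle[OF that] mgt[OF that] that by (auto simp: xy v_def w_def)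
  moreover have "box_volume d w - box_volume d v \<le> u * box_volume d x"
  proof -
    have "box_volume d v = (\<Prod>j<d. exp (- h) * w j)"
      unfolding box_volume_def v_def w_def by (intro prod.cong) (auto simp: exp_add[symmetric] algebra_simps)
    also have "\<dots> = exp (- h * real d) * box_volume d w"
      by (simp add: prod.distrib box_volume_def exp_of_nat_mult[symmetric] mult.commute)
    finally have vw: "box_volume d v = exp (- h * real d) * box_volume d w" .
    have "h * real d = u / (1 + u)" using d by (simp add: h)
    then have "1 / (1 + u) = 1 - h * real d" using u by (simp add: field_simps)
    also have "\<dots> \<le> exp (- h * real d)" using exp_ge_add_one_self[of "- h * real d"] by simp
    finally have "1 \<le> (1 + u) * exp (- h * real d)" using u by (simp add: field_simps)
    moreover have "0 \<le> box_volume d w" by (auto simp: box_volume_def w_def intro!: prod_nonneg)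
    ultimately have "1 * box_volume d w \<le> ((1 + u) * exp (- h * real d)) * box_volume d w"
      by (intro mult_right_mono)
    then have "box_volume d w - box_volume d v \<le> u * box_volume d v"
      unfolding vw by (simp add: algebra_simps)
    also have "\<dots> \<le> u * box_volume d x"
      unfolding box_volume_def using u vx by (intro mult_left_mono prod_mono) (auto simp: v_def)
    finally show ?thesis .
  qed
  ultimately show ?thesis by blast
qed

text \<open>
  Layer \<open>i\<close> uses the relative precision \<open>u = 2^i * \<delta>\<close>, which amounts to the absolute precision \<open>\<delta>\<close> since the volumes in that layer
  are at most \<open>1/2^i\<close>. As each \<open>layer_count\<close> is at most 1, its \<open>d\<close>-th power is at most its square,
  and the sum of the squares over all layers has a bound independent of \<open>d\<close> and \<open>\<delta>\<close>. This is where \<open>d \<ge> 2\<close> enters.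
\<close>

lemma ex_bracketing_cover:
  assumes d: "2 \<le> d" and \<delta>: "0 < \<delta>" "\<delta> \<le> 1/5000"
  shows "\<exists>\<Gamma>. finite \<Gamma> \<and> \<Gamma> \<subseteq> {..<d} \<rightarrow>\<^sub>E {0..1} \<and> real (card \<Gamma>) \<le> 2/5 * (3 / \<delta>) ^ d \<and>
    (\<forall>x\<in>{..<d} \<rightarrow>\<^sub>E {0..1}. \<delta> \<le> box_volume d x \<longrightarrow>
       (\<exists>v\<in>\<Gamma>. \<exists>w\<in>\<Gamma>. (\<forall>j<d. v j \<le> x j \<and> x j \<le> w j) \<and> box_volume d w - box_volume d v \<le> \<delta>))"
proof -
  define I where "I = {i::nat. 2 ^ i * \<delta> \<le> 1}"
  define h where "h i = 2 ^ i * \<delta> / ((1 + 2 ^ i * \<delta>) * real d)" for i :: nat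
  define N where "N i = nat \<lfloor>real (i + 1) * ln 2 / h i\<rfloor> + d" for i :: nat
  define \<Gamma> where "\<Gamma> = (\<Union>i\<in>I. exp_lattice d (h i) (N i))"
  have h0: "0 < h i" for i unfolding h_def using \<delta> d by (intro divide_pos_pos mult_pos_pos add_pos_pos) auto
  have finI: "finite I"
  proof -
    obtain n where n: "1 / \<delta> < 2 ^ n" using real_arch_pow[of 2 "1/\<delta>"] by auto
    have "I \<subseteq> {..<n}"
    proof
      fix i assume "i \<in> I"
      then have "2 ^ i \<le> 1 / \<delta>" using \<delta> by (simp add: I_def field_simps)
      with n have "(2::real) ^ i < 2 ^ n" by linarith
      then show "i \<in> {..<n}" by simp
    qed
    then show ?thesis using finite_subset by blast
  qed
  have card_layer: "real (card (exp_lattice d (h i) (N i))) \<le> 2 * 3 ^ (d - 2) / \<delta> ^ d * (layer_count \<delta> i)\<^sup>2"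
    if i: "i \<in> I" for i
  proof -
    note lb = layer_count_bounds[OF \<delta>, of i]
    have iI: "2 ^ i * \<delta> \<le> 1" using i by (simp add: I_def)
    have "real (N i + d) \<le> real (i + 1) * ln 2 / h i + 2 * real d"
      unfolding N_def using h0[of i] by (simp add: of_nat_nat)
    also have "1 / h i = real d * (1 / (2 ^ i * \<delta>) + 1)"
      using d \<delta> by (simp add: h_def field_simps)
    then have "real (i + 1) * ln 2 / h i = real (i + 1) * ln 2 * (real d * (1 / (2 ^ i * \<delta>) + 1))"
      by (metis times_divide_eq_right mult.right_neutral)
    also have "\<dots> + 2 * real d = real d / \<delta> * layer_count \<delta> i"
      using \<delta> by (simp add: layer_count_def field_simps)
    finally have Nd: "real (N i + d) \<le> real d / \<delta> * layer_count \<delta> i" .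
    have "real (card (exp_lattice d (h i) (N i))) \<le> real ((N i + d) choose d)"
      using finite_exp_lattice_card(2) of_nat_le_iff by blast
    also have "\<dots> \<le> real (N i + d) ^ d / fact d"
    proof -
      have "real (((N i + d) choose d) * fact d) \<le> real ((N i + d) ^ d)"
        using binomial_fact_pow of_nat_le_iff by blast
      then show ?thesis by (simp add: field_simps)
    qed
    also have "\<dots> \<le> (real d / \<delta> * layer_count \<delta> i) ^ d / fact d"
      using Nd by (intro divide_right_mono power_mono) auto
    also have "\<dots> = real d ^ d / fact d * (1 / \<delta> ^ d * layer_count \<delta> i ^ d)"
      by (simp add: power_mult_distrib power_divide)
    also have "\<dots> \<le> (2 * 3 ^ (d - 2)) * (1 / \<delta> ^ d * (layer_count \<delta> i)\<^sup>2)"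
      using power_self_le_fact[OF d] lb[OF iI] d \<delta>
      by (intro mult_mono mult_nonneg_nonneg power_decreasing) (auto simp: divide_le_eq)
    finally show ?thesis by simp
  qed
  have "real (card \<Gamma>) \<le> (\<Sum>i\<in>I. real (card (exp_lattice d (h i) (N i))))"
    unfolding \<Gamma>_def of_nat_sum[symmetric] of_nat_le_iff using finI by (rule card_UN_le)
  also have "\<dots> \<le> (\<Sum>i\<in>I. 2 * 3 ^ (d - 2) / \<delta> ^ d * (layer_count \<delta> i)\<^sup>2)"
    using card_layer by (intro sum_mono)
  also have "\<dots> \<le> 2 * 3 ^ (d - 2) / \<delta> ^ d * 1.8"
    unfolding sum_distrib_left[symmetric] using \<delta> finI
    by (intro mult_left_mono sum_layer_count_squares) (auto simp: I_def)
  also have "\<dots> = 2/5 * (3 / \<delta>) ^ d"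
  proof -
    have "(3::real) ^ d = 9 * 3 ^ (d - 2)"
      using d by (auto simp: le_iff_add power_add)
    then show ?thesis by (simp add: power_divide)
  qed
  finally have card: "real (card \<Gamma>) \<le> 2/5 * (3 / \<delta>) ^ d" .
  show ?thesis
  proof (intro exI[of _ \<Gamma>] conjI card ballI impI)
    show "finite \<Gamma>" unfolding \<Gamma>_def using finI finite_exp_lattice_card(1) by blast
    show "\<Gamma> \<subseteq> {..<d} \<rightarrow>\<^sub>E {0..1}"
      unfolding \<Gamma>_def using exp_lattice_subset[OF less_imp_le[OF h0]] by blast
    fix x assume x: "x \<in> {..<d} \<rightarrow>\<^sub>E {0..1::real}" and V: "\<delta> \<le> box_volume d x"
    have "box_volume d x \<le> 1"
      unfolding box_volume_def using x by (intro prod_le_1) (auto simp: PiE_iff)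
    then obtain i where i: "box_volume d x \<le> 1 / 2 ^ i" "1 / 2 ^ (i + 1) < box_volume d x"
      using ex_dyadic_layer V \<delta> by (meson less_le_trans)
    have "\<delta> \<le> 1 / 2 ^ i" using i(1) V by linarith
    then have iI: "i \<in> I" by (simp add: I_def field_simps)
    obtain v w where vw: "v \<in> exp_lattice d (h i) (N i)" "w \<in> exp_lattice d (h i) (N i)"
      "\<forall>j<d. v j \<le> x j \<and> x j \<le> w j"
      "box_volume d w - box_volume d v \<le> 2 ^ i * \<delta> * box_volume d x"
      using exp_lattice_brackets_layer[OF _ _ x i(2) h_def[of i] N_def[of i]] d \<delta> by auto
    have "2 ^ i * \<delta> * box_volume d x \<le> 2 ^ i * \<delta> * (1 / 2 ^ i)"
      using i(1) \<delta> by (intro mult_left_mono) auto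
    then have "box_volume d w - box_volume d v \<le> \<delta>" using vw(4) by simp
    with vw iI show "\<exists>v\<in>\<Gamma>. \<exists>w\<in>\<Gamma>. (\<forall>j<d. v j \<le> x j \<and> x j \<le> w j) \<and> box_volume d w - box_volume d v \<le> \<delta>"
      unfolding \<Gamma>_def by blast
  qed
qed

section \<open>From a cover to the star discrepancy\<close>

definition local_discrepancy :: "nat \<Rightarrow> (nat \<Rightarrow> real) set \<Rightarrow> (nat \<Rightarrow> real) \<Rightarrow> real" where
  "local_discrepancy d P x = 1 / real (card P) * (\<Sum>p\<in>P. indicator (anchored_box d x) p) - box_volume d x"

lemma anchored_box_mono:
  assumes "\<And>j. j < d \<Longrightarrow> x j \<le> y j"
  shows "anchored_box d x \<subseteq> anchored_box d y"
  unfolding anchored_box_def using assms by (intro PiE_mono) force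

lemma box_volume_mono:
  assumes "x \<in> {..<d} \<rightarrow>\<^sub>E {0..1}" "\<And>j. j < d \<Longrightarrow> x j \<le> y j"
  shows "box_volume d x \<le> box_volume d y"
  unfolding box_volume_def using assms by (intro prod_mono) (auto simp: PiE_iff)

lemma box_volume_bounds:
  assumes "x \<in> {..<d} \<rightarrow>\<^sub>E {0..1}"
  shows "0 \<le> box_volume d x" "box_volume d x \<le> 1"
  unfolding box_volume_def using assms
  by (auto simp: PiE_iff intro!: prod_nonneg prod_le_1)

lemma empirical_measure_mono:
  fixes P :: "'a set"
  assumes "A \<subseteq> B"
  shows "1 / real (card P) * (\<Sum>p\<in>P. indicator A p) \<le> 1 / real (card P) * (\<Sum>p\<in>P. indicator B p :: real)"
  using assms by (intro mult_left_mono sum_mono) (auto simp: indicator_def)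

lemma empirical_measure_bounds:
  shows "0 \<le> 1 / real (card P) * (\<Sum>p\<in>P. indicator A p :: real)"
    and "1 / real (card P) * (\<Sum>p\<in>P. indicator A p :: real) \<le> 1"
proof -
  show "0 \<le> 1 / real (card P) * (\<Sum>p\<in>P. indicator A p :: real)" by (simp add: sum_nonneg)
  have "(\<Sum>p\<in>P. indicator A p :: real) \<le> (\<Sum>p\<in>P. 1)" by (intro sum_mono) (simp add: indicator_def)
  then show "1 / real (card P) * (\<Sum>p\<in>P. indicator A p :: real) \<le> 1" by (simp add: divide_le_eq)
qed

lemma local_discrepancy_le_1:
  assumes "x \<in> {..<d} \<rightarrow>\<^sub>E {0..1}"
  shows "\<bar>local_discrepancy d P x\<bar> \<le> 1"
  using box_volume_bounds[OF assms] empirical_measure_bounds[of P "anchored_box d x"]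
  unfolding local_discrepancy_def by linarith

lemma star_discrepancy_leI:
  assumes "\<And>x. x \<in> {..<d} \<rightarrow>\<^sub>E {0..1} \<Longrightarrow> \<bar>local_discrepancy d P x\<bar> \<le> b"
  shows "star_discrepancy d P \<le> b"
proof -
  have "(\<lambda>j\<in>{..<d}. 0) \<in> {..<d} \<rightarrow>\<^sub>E {0..1::real}" by auto
  then have "{..<d} \<rightarrow>\<^sub>E {0..1::real} \<noteq> {}" by blast
  then show ?thesis
    unfolding star_discrepancy_def using assms[unfolded local_discrepancy_def]
    by (intro cSUP_least) auto
qed

lemma star_discrepancy_nonneg: "0 \<le> star_discrepancy d P"
proof -
  have x: "(\<lambda>j\<in>{..<d}. 0) \<in> {..<d} \<rightarrow>\<^sub>E {0..1::real}" (is "?x \<in> ?X") by auto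
  have "bdd_above ((\<lambda>x. \<bar>local_discrepancy d P x\<bar>) ` ?X)"
    using local_discrepancy_le_1 by (intro bdd_aboveI2[where M = 1])
  from cSUP_upper[OF x this] have "\<bar>local_discrepancy d P ?x\<bar> \<le> star_discrepancy d P"
    by (simp add: star_discrepancy_def local_discrepancy_def)
  then show ?thesis by linarith
qed

lemma min_star_discrepancy_leI:
  assumes "P \<in> point_sets n d"
    and "\<And>x. x \<in> {..<d} \<rightarrow>\<^sub>E {0..1} \<Longrightarrow> \<bar>local_discrepancy d P x\<bar> \<le> b"
  shows "min_star_discrepancy n d \<le> b"
proof -
  have "min_star_discrepancy n d \<le> star_discrepancy d P"
    unfolding min_star_discrepancy_def using assms(1) star_discrepancy_nonneg
    by (intro cINF_lower bdd_belowI2[where m = 0])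
  also have "\<dots> \<le> b" using assms(2) by (rule star_discrepancy_leI)
  finally show ?thesis .
qed

text \<open>
  Raising all coordinates to at least \<open>s\<close> moves the volume continuously from its original value to 1.
\<close>

lemma ex_enlargement_with_box_volume:
  assumes x: "x \<in> {..<d} \<rightarrow>\<^sub>E {0..1}" and \<delta>: "box_volume d x \<le> \<delta>" "\<delta> \<le> 1"
  shows "\<exists>y\<in>{..<d} \<rightarrow>\<^sub>E {0..1}. (\<forall>j<d. x j \<le> y j) \<and> box_volume d y = \<delta>"
proof -
  define y where "y s = (\<lambda>j\<in>{..<d}. max (x j) s)" for s :: real
  have "box_volume d (y 0) = box_volume d x"
    unfolding box_volume_def y_def using x by (intro prod.cong) (auto simp: PiE_iff max_absorb1)
  moreover have "box_volume d (y 1) = 1"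
    unfolding box_volume_def y_def using x by (intro prod.neutral) (auto simp: PiE_iff max_def)
  moreover have "continuous_on {0..1} (\<lambda>s. box_volume d (y s))"
    unfolding box_volume_def y_def by (auto intro!: continuous_intros)
  ultimately obtain s where s: "0 \<le> s" "s \<le> 1" "box_volume d (y s) = \<delta>"
    using IVT'[of "\<lambda>s. box_volume d (y s)" 0 \<delta> 1] \<delta> by auto
  show ?thesis
    using s x by (intro bexI[of _ "y s"]) (auto simp: y_def PiE_iff)
qed

text \<open>
  By monotonicity of the empirical measure and of the volume. A box smaller than \<open>\<delta>\<close> is first enlarged to
  volume exactly \<open>\<delta>\<close>, which costs a second \<open>\<delta>\<close>.
\<close>

lemma local_discrepancy_le_cover:
  assumes \<delta>: "0 < \<delta>" "\<delta> \<le> 1"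
    and sub: "\<Gamma> \<subseteq> {..<d} \<rightarrow>\<^sub>E {0..1}"
    and cover: "\<And>x. x \<in> {..<d} \<rightarrow>\<^sub>E {0..1} \<Longrightarrow> \<delta> \<le> box_volume d x \<Longrightarrow>
       \<exists>v\<in>\<Gamma>. \<exists>w\<in>\<Gamma>. (\<forall>j<d. v j \<le> x j \<and> x j \<le> w j) \<and> box_volume d w - box_volume d v \<le> \<delta>"
    and disc: "\<And>v. v \<in> \<Gamma> \<Longrightarrow> \<bar>local_discrepancy d P v\<bar> \<le> b" and b: "0 \<le> b"
    and x: "x \<in> {..<d} \<rightarrow>\<^sub>E {0..1}"
  shows "\<bar>local_discrepancy d P x\<bar> \<le> b + 2 * \<delta>"
proof (cases "\<delta> \<le> box_volume d x")
  case True
  then obtain v w where v: "v \<in> \<Gamma>" and w: "w \<in> \<Gamma>"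
    and vxw: "\<And>j. j < d \<Longrightarrow> v j \<le> x j" "\<And>j. j < d \<Longrightarrow> x j \<le> w j"
    and diff: "box_volume d w - box_volume d v \<le> \<delta>"
    using cover[OF x] by blast
  have vol: "box_volume d v \<le> box_volume d x" "box_volume d x \<le> box_volume d w"
    using v sub x vxw by (auto intro!: box_volume_mono)
  have "anchored_box d v \<subseteq> anchored_box d x" "anchored_box d x \<subseteq> anchored_box d w"
    using vxw by (auto intro!: anchored_box_mono del: subsetI)
  from this[THEN empirical_measure_mono, where P = P] show ?thesis
    using
      disc[OF v] disc[OF w] diff vol \<delta>(1)
    unfolding local_discrepancy_def by (smt (verit))
next
  case False
  then obtain y where y: "y \<in> {..<d} \<rightarrow>\<^sub>E {0..1}" "\<And>j. j < d \<Longrightarrow> x j \<le> y j" "box_volume d y = \<delta>"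
    using ex_enlargement_with_box_volume[OF x _ \<delta>(2)] by auto
  then obtain v w where v: "v \<in> \<Gamma>" and w: "w \<in> \<Gamma>"
    and vyw: "\<And>j. j < d \<Longrightarrow> v j \<le> y j" "\<And>j. j < d \<Longrightarrow> y j \<le> w j"
    and diff: "box_volume d w - box_volume d v \<le> \<delta>"
    using cover[OF y(1)] by auto
  have "box_volume d v \<le> box_volume d y" using v sub vyw by (auto intro!: box_volume_mono)
  moreover have "anchored_box d x \<subseteq> anchored_box d w"
    using y(2) vyw(2) by (intro anchored_box_mono) (meson order_trans)
  note empirical_measure_mono[OF this, where P = P]
  ultimately show ?thesis
    using disc[OF w] diff y(3) box_volume_bounds[OF x] False b \<delta>(1)
      empirical_measure_bounds(1)[of P "anchored_box d x"]
    unfolding local_discrepancy_def by (smt (verit))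
qed

text \<open>
  The assumption \<open>total\<close> is the union bound: level 0 contributes Hoeffding bounds for at most \<open>(2/5) (3/\<delta>\<^sub>0)^d\<close> boxes
  and two signs, level \<open>k+1\<close> contributes bounds for remainders of volume at most \<open>\<delta>\<^sub>k\<close>. Those are optimal for
  the parameter \<open>t\<^sub>k\<^sub>+\<^sub>1 / (2 \<delta>\<^sub>k)\<close> of the exponential moment, which has to be at most 1; this is the assumption on \<open>t\<close>.
\<close>

lemma min_star_discrepancy_chaining:
  fixes \<delta> t :: "nat \<Rightarrow> real"
  assumes d: "2 \<le> d" and n: "1 \<le> n"
    and \<delta>: "\<And>k. k \<le> K \<Longrightarrow> 0 < \<delta> k" "\<And>k. k \<le> K \<Longrightarrow> \<delta> k \<le> 1/5000"
    and t: "\<And>k. k \<le> K \<Longrightarrow> 0 < t k" and t_le: "\<And>k. k < K \<Longrightarrow> t (Suc k) \<le> 2 * \<delta> k"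
    and total: "4/5 * (3 / \<delta> 0) ^ d * exp (- 2 * real n * (t 0)\<^sup>2) +
       (\<Sum>k<K. 4/5 * (3 / \<delta> (Suc k)) ^ d * exp (- real n * (t (Suc k))\<^sup>2 / (4 * \<delta> k))) \<le> 1"
  shows "min_star_discrepancy n d \<le> (\<Sum>k\<le>K. t k) + 2 * \<delta> K"
proof -
  interpret prob_space "uniform_cube d" by (rule prob_space_uniform_cube)
  define X where "X = ({..<d} \<rightarrow>\<^sub>E {0..1} :: (nat \<Rightarrow> real) set)"
  \<comment> \<open>the corner of the empty box; it is the predecessor of the boxes that are too small to contain a box of the coarser cover\<close>
  define zero :: "nat \<Rightarrow> real" where "zero = (\<lambda>j\<in>{..<d}. 0)"
  have zero: "zero \<in> X" by (auto simp: zero_def X_def)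
  have box_zero: "anchored_box d zero = {}"
    unfolding anchored_box_def PiE_eq_empty_iff using d by (intro bexI[of _ 0]) (auto simp: zero_def)
  have vol_zero: "box_volume d zero = 0" using d by (auto simp: box_volume_def zero_def)
  define is_cover where "is_cover k G \<longleftrightarrow> finite G \<and> G \<subseteq> X \<and> real (card G) \<le> 2/5 * (3 / \<delta> k) ^ d \<and>
    (\<forall>x\<in>X. \<delta> k \<le> box_volume d x \<longrightarrow>
       (\<exists>v\<in>G. \<exists>w\<in>G. (\<forall>j<d. v j \<le> x j \<and> x j \<le> w j) \<and> box_volume d w - box_volume d v \<le> \<delta> k))" for k G
  have "\<forall>k\<in>{..K}. \<exists>G. is_cover k G"
    unfolding is_cover_def X_def using \<delta> by (intro ballI ex_bracketing_cover d) auto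
  from bchoice[OF this] obtain \<Gamma> where \<Gamma>: "\<forall>k\<in>{..K}. is_cover k (\<Gamma> k)" ..
  have fin: "finite (\<Gamma> k)" and sub: "\<Gamma> k \<subseteq> X" and card: "real (card (\<Gamma> k)) \<le> 2/5 * (3 / \<delta> k) ^ d"
    and cover: "\<And>x. x \<in> X \<Longrightarrow> \<delta> k \<le> box_volume d x \<Longrightarrow>
       \<exists>v\<in>\<Gamma> k. \<exists>w\<in>\<Gamma> k. (\<forall>j<d. v j \<le> x j \<and> x j \<le> w j) \<and> box_volume d w - box_volume d v \<le> \<delta> k"
    if k: "k \<le> K" for k
  proof -
    have "is_cover k (\<Gamma> k)" using \<Gamma> k by simp
    then show "finite (\<Gamma> k)" "\<Gamma> k \<subseteq> X" "real (card (\<Gamma> k)) \<le> 2/5 * (3 / \<delta> k) ^ d"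
      "\<And>x. x \<in> X \<Longrightarrow> \<delta> k \<le> box_volume d x \<Longrightarrow>
         \<exists>v\<in>\<Gamma> k. \<exists>w\<in>\<Gamma> k. (\<forall>j<d. v j \<le> x j \<and> x j \<le> w j) \<and> box_volume d w - box_volume d v \<le> \<delta> k"
      unfolding is_cover_def by blast+
  qed
  define is_lower where "is_lower k x v \<longleftrightarrow> v \<in> insert zero (\<Gamma> k) \<and> (\<forall>j<d. v j \<le> x j) \<and>
    box_volume d x - box_volume d v \<le> \<delta> k" for k and x v :: "nat \<Rightarrow> real"
  have "\<exists>v. is_lower k x v"
    if k: "k \<le> K" and x: "x \<in> X" for k x
  proof (cases "\<delta> k \<le> box_volume d x")
    case True
    then obtain v w where vw: "v \<in> \<Gamma> k" "w \<in> \<Gamma> k" "\<forall>j<d. v j \<le> x j \<and> x j \<le> w j"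
      "box_volume d w - box_volume d v \<le> \<delta> k" using cover[OF k x True] by blast
    moreover have "box_volume d x \<le> box_volume d w"
      using vw x by (intro box_volume_mono) (auto simp: X_def)
    ultimately show ?thesis by (intro exI[of _ v]) (auto simp: is_lower_def)
  next
    case False
    have "\<forall>j<d. zero j \<le> x j" using x by (auto simp: zero_def X_def PiE_iff)
    with False show ?thesis by (intro exI[of _ zero]) (simp add: is_lower_def vol_zero)
  qed
  then obtain \<rho> where "\<And>k x. k \<le> K \<Longrightarrow> x \<in> X \<Longrightarrow> is_lower k x (\<rho> k x)" by metis
  then have \<rho>: "\<And>k x. k \<le> K \<Longrightarrow> x \<in> X \<Longrightarrow> \<rho> k x \<in> insert zero (\<Gamma> k)"
    "\<And>k x j. k \<le> K \<Longrightarrow> x \<in> X \<Longrightarrow> j < d \<Longrightarrow> \<rho> k x j \<le> x j"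
    "\<And>k x. k \<le> K \<Longrightarrow> x \<in> X \<Longrightarrow> box_volume d x - box_volume d (\<rho> k x) \<le> \<delta> k"
    unfolding is_lower_def by blast+
  \<comment> \<open>\<open>\<rho> k\<close> rounds down to the cover of level \<open>k\<close>, so the predecessor of a box of level \<open>k\<close> comes from level \<open>k - 1\<close>\<close>
  define prev where "prev k x = (case k of 0 \<Rightarrow> zero | Suc k' \<Rightarrow> \<rho> k' x)" for k x
  have prevX: "prev k x \<in> X" and prev_le: "\<And>j. j < d \<Longrightarrow> prev k x j \<le> x j" if "k \<le> K" "x \<in> X" for k x
  proof -
    have "prev k x \<in> X \<and> (\<forall>j<d. prev k x j \<le> x j)"
    proof (cases k)
      case 0
      then show ?thesis using zero that by (auto simp: prev_def zero_def X_def PiE_iff)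
    next
      case (Suc k')
      then have "\<rho> k' x \<in> X" using \<rho>(1)[of k' x] sub[of k'] zero that by auto
      then show ?thesis using \<rho>(2)[of k' x] Suc that by (simp add: prev_def)
    qed
    then show "prev k x \<in> X" "\<And>j. j < d \<Longrightarrow> prev k x j \<le> x j" by auto
  qed
  define E where "E = (\<lambda>(k, x). anchored_box d x - anchored_box d (prev k x))"
  have prev_sub: "anchored_box d (prev k x) \<subseteq> anchored_box d x" if "k \<le> K" "x \<in> X" for k x
    using prev_le[OF that] by (rule anchored_box_mono)
  have E_ev: "E (k, x) \<in> events" and E_prob: "prob (E (k, x)) = box_volume d x - box_volume d (prev k x)"
    if "k \<le> K" "x \<in> X" for k x
  proof -
    have *: "anchored_box d x \<in> events" "anchored_box d (prev k x) \<in> events"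
      using that prevX[OF that] by (auto simp: X_def intro!: anchored_box_in_sets_uniform_cube)
    then show "E (k, x) \<in> events" by (simp add: E_def)
    have "prob (E (k, x)) = prob (anchored_box d x) - prob (anchored_box d (prev k x))"
      unfolding E_def using * prev_sub[OF that] by (simp add: finite_measure_Diff)
    then show "prob (E (k, x)) = box_volume d x - box_volume d (prev k x)"
      using that prevX[OF that] by (simp add: measure_anchored_box X_def)
  qed
  define l where "l = (\<lambda>(k, x::nat \<Rightarrow> real). case k of 0 \<Rightarrow> 4 * t 0 | Suc k' \<Rightarrow> t k / (2 * \<delta> k'))"
  define \<psi> where "\<psi> = (\<lambda>(k, x::nat \<Rightarrow> real). case k of 0 \<Rightarrow> 2 * (t 0)\<^sup>2 | Suc k' \<Rightarrow> (t k)\<^sup>2 / (4 * \<delta> k'))"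
  define A where "A = (SIGMA k:{..K}. \<Gamma> k)"
  have "\<exists>P\<subseteq>space (uniform_cube d). finite P \<and> card P = n \<and>
           (\<forall>a\<in>A. \<bar>(\<Sum>p\<in>P. indicator (E a) p) / real n - prob (E a)\<bar> \<le> t (fst a))"
  proof (rule ex_point_set_simultaneous_deviation[where l = l and \<psi> = \<psi>])
    show "AE x in uniform_cube d. x \<noteq> p" if "p \<in> space (uniform_cube d)" for p
      using d that by (intro AE_uniform_cube_neq) auto
    show "finite A" unfolding A_def using fin by (intro finite_SigmaI) auto
    show "1 \<le> n" by fact
  next
    fix a assume a: "a \<in> A"
    then obtain k x where kx: "a = (k, x)" "k \<le> K" "x \<in> \<Gamma> k" "x \<in> X" using sub by (auto simp: A_def)
    show ev: "E a \<in> events" using E_ev kx by simp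
    show "0 < l a" using kx t[of k] \<delta>(1)[of "k - 1"] by (auto simp: l_def split: nat.splits)
    show "expectation (\<lambda>y. exp (s * l a * (indicator (E a) y - prob (E a)))) \<le> exp (\<psi> a)"
      if s: "s \<in> {1, -1}" for s
    proof (cases k)
      case 0
      have "expectation (\<lambda>y. exp (s * l a * (indicator (E a) y - prob (E a)))) \<le> exp ((s * l a)\<^sup>2 / 8)"
        by (rule mgf_centred_indicator_le_Hoeffding[OF ev])
      also have "(s * l a)\<^sup>2 / 8 = \<psi> a" using s by (auto simp: kx 0 l_def \<psi>_def power2_eq_square)
      finally show ?thesis .
    next
      case (Suc k')
      have d0: "0 < \<delta> k'" using kx Suc \<delta> by auto
      have "prob (E a) \<le> \<delta> k'" using E_prob[of k x] \<rho>(3)[of k' x] kx Suc by (simp add: prev_def)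
      moreover have "\<bar>s * l a\<bar> \<le> 1"
        using t_le[of k'] t[of k] d0 kx Suc s by (auto simp: l_def)
      ultimately have "expectation (\<lambda>y. exp (s * l a * (indicator (E a) y - prob (E a)))) \<le> exp (\<delta> k' * (s * l a)\<^sup>2)"
        by (intro mgf_centred_indicator_le_small ev)
      also have "\<delta> k' * (s * l a)\<^sup>2 = \<psi> a"
        using s d0 by (auto simp: kx Suc l_def \<psi>_def power2_eq_square field_simps)
      finally show ?thesis .
    qed
  next
    have "(\<Sum>a\<in>A. 2 * exp (real n * (\<psi> a - l a * t (fst a)))) =
        (\<Sum>k\<le>K. \<Sum>x\<in>\<Gamma> k. 2 * exp (real n * (\<psi> (k, x) - l (k, x) * t k)))"
      unfolding A_def using fin by (subst sum.Sigma) (auto intro!: sum.cong)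
    also have "\<dots> = (\<Sum>k\<le>K. real (card (\<Gamma> k)) * (2 * exp (real n * (\<psi> (k, zero) - l (k, zero) * t k))))"
      by (simp add: \<psi>_def l_def)
    also have "\<dots> \<le> (\<Sum>k\<le>K. 2/5 * (3 / \<delta> k) ^ d * (2 * exp (real n * (\<psi> (k, zero) - l (k, zero) * t k))))"
      using card by (intro sum_mono mult_right_mono) auto
    also have "\<dots> = 4/5 * (3 / \<delta> 0) ^ d * exp (- 2 * real n * (t 0)\<^sup>2) +
       (\<Sum>k<K. 4/5 * (3 / \<delta> (Suc k)) ^ d * exp (- real n * (t (Suc k))\<^sup>2 / (4 * \<delta> k)))"
    proof -
      have "real n * (\<psi> (0, zero) - l (0, zero) * t 0) = - 2 * real n * (t 0)\<^sup>2"
        by (simp add: \<psi>_def l_def power2_eq_square algebra_simps)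
      moreover have "real n * (\<psi> (Suc k, zero) - l (Suc k, zero) * t (Suc k)) = - real n * (t (Suc k))\<^sup>2 / (4 * \<delta> k)"
        if "k < K" for k
        using \<delta>(1)[of k] that by (simp add: \<psi>_def l_def power2_eq_square field_simps)
      ultimately show ?thesis
        unfolding lessThan_Suc_atMost[symmetric] sum.lessThan_Suc_shift by (simp add: mult.assoc)
    qed
    also have "\<dots> \<le> 1" by (rule total)
    finally show "(\<Sum>a\<in>A. 2 * exp (real n * (\<psi> a - l a * t (fst a)))) \<le> 1" .
  qed
  then obtain P where P: "P \<subseteq> space (uniform_cube d)" "finite P" "card P = n"
    and dev: "\<And>k x. k \<le> K \<Longrightarrow> x \<in> \<Gamma> k \<Longrightarrow> \<bar>(\<Sum>p\<in>P. indicator (E (k, x)) p) / real n - prob (E (k, x))\<bar> \<le> t k"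
    by (auto simp: A_def)
  have D_zero: "local_discrepancy d P zero = 0"
    by (simp add: local_discrepancy_def box_zero vol_zero)
  have chain: "\<bar>local_discrepancy d P x - local_discrepancy d P (prev k x)\<bar> \<le> t k"
    if k: "k \<le> K" and x: "x \<in> \<Gamma> k" for k x
  proof -
    have xX: "x \<in> X" using sub k x by blast
    have "(\<Sum>p\<in>P. indicator (E (k, x)) p) =
        (\<Sum>p\<in>P. indicator (anchored_box d x) p - indicator (anchored_box d (prev k x)) p :: real)"
      unfolding E_def using prev_sub[OF k xX] by (intro sum.cong) (auto simp: indicator_def)
    then have "(\<Sum>p\<in>P. indicator (E (k, x)) p) / real n - prob (E (k, x)) =
        local_discrepancy d P x - local_discrepancy d P (prev k x)"
      using E_prob[OF k xX] P(3) by (simp add: local_discrepancy_def sum_subtractf diff_divide_distrib)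
    with dev[OF k x] show ?thesis by simp
  qed
  have t_sum: "0 \<le> (\<Sum>i\<le>k. t i)" if "k \<le> K" for k
    using t that by (intro sum_nonneg less_imp_le) auto
  have bound: "\<bar>local_discrepancy d P x\<bar> \<le> (\<Sum>i\<le>k. t i)" if "k \<le> K" "x \<in> insert zero (\<Gamma> k)" for k x
    using that
  proof (induction k arbitrary: x)
    case 0
    then show ?case using chain[of 0 x] t[of 0] D_zero by (auto simp: prev_def)
  next
    case (Suc k)
    show ?case
    proof (cases "x = zero")
      case True
      then show ?thesis using t_sum[OF Suc.prems(1)] by (simp add: D_zero)
    next
      case False
      then have x: "x \<in> \<Gamma> (Suc k)" using Suc.prems by simp
      then have "\<rho> k x \<in> insert zero (\<Gamma> k)" using Suc.prems sub by (intro \<rho>(1)) auto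
      then have "\<bar>local_discrepancy d P (\<rho> k x)\<bar> \<le> (\<Sum>i\<le>k. t i)" using Suc by auto
      then show ?thesis using chain[OF Suc.prems(1) x] by (simp add: prev_def)
    qed
  qed
  show ?thesis
  proof (rule min_star_discrepancy_leI)
    show "P \<in> point_sets n d" using P by (simp add: point_sets_def space_uniform_cube)
    fix x :: "nat \<Rightarrow> real" assume "x \<in> {..<d} \<rightarrow>\<^sub>E {0..1}"
    then show "\<bar>local_discrepancy d P x\<bar> \<le> (\<Sum>k\<le>K. t k) + 2 * \<delta> K"
      using \<delta>[of K] sub[of K] cover[of K] bound[of K] t_sum[of K]
      by (intro local_discrepancy_le_cover[where \<Gamma> = "\<Gamma> K"]) (auto simp: X_def)
  qed
qed

section \<open>The constants of the chain\<close>

lemma exp_ge_quadratic_power: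
  fixes x :: real
  assumes "0 \<le> x"
  shows "(1 + x + x\<^sup>2 / 2) ^ m \<le> exp (real m * x)"
  unfolding exp_of_nat_mult using assms exp_lower_Taylor_quadratic by (intro power_mono) auto

lemma sum_geometric_le:
  fixes q :: real
  assumes "0 \<le> q" "q < 1"
  shows "(\<Sum>k<m. q ^ k) \<le> 1 / (1 - q)"
proof -
  have "(\<Sum>k<m. q ^ k) = (1 - q ^ m) / (1 - q)" using assms by (simp add: sum_gp_strict)
  also have "\<dots> \<le> 1 / (1 - q)" using assms by (intro divide_right_mono) auto
  finally show ?thesis .
qed

text \<open>
  These two lemmas bound, up to constant factors, the \<open>d\<close>-th root of the number of sets in a level times their
  failure probability;
  \<open>9.68 = 2 * 2.2^2\<close>, and \<open>15.3\<close> is just below \<open>0.1107^2 * 5000 / 4\<close>. The powers of exponentials are split so that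
  only small numerals are evaluated.
\<close>

lemma level_zero_failure: "15000 * exp (- 9.68) \<le> (0.95::real)"
proof -
  have "1.83 \<le> (1.0565 :: real) ^ 11" by (simp add: power_divide)
  also have "\<dots> \<le> (1 + 0.055 + 0.055\<^sup>2 / 2) ^ 11" by (intro power_mono) (auto simp: power2_eq_square)
  also have "\<dots> \<le> exp (real 11 * 0.055)" by (rule exp_ge_quadratic_power) simp
  finally have "1.83 ^ 16 \<le> exp (0.605::real) ^ 16" by (intro power_mono) auto
  also have "\<dots> = exp 9.68" by (simp flip: exp_of_nat_mult)
  finally have "1.83 ^ 16 \<le> exp (9.68::real)" .
  moreover have "15000 / 0.95 \<le> (1.83::real) ^ 16" by (simp add: power_divide)
  ultimately have "15000 / 0.95 \<le> exp (9.68::real)" by linarith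
  then show ?thesis by (simp add: exp_minus field_simps)
qed

text \<open>
  The precision improves by the factor 100 per level, but the squares of the deviations shrink only by 64. So the exponent grows like
  \<open>(100/64)^k\<close> and beats the growth \<open>100^k\<close> of the covers.
\<close>

lemma level_Suc_failure:
  "15000 * 100 ^ Suc k * exp (- 15.3 * (25/16) ^ k) \<le> 0.4 * (1/2::real) ^ k"
proof -
  have "2.45 \<le> (1.105 :: real) ^ 9" by (simp add: power_divide)
  also have "\<dots> = (1 + 0.1 + 0.1\<^sup>2 / 2) ^ 9" by (simp add: power2_eq_square)
  also have "\<dots> \<le> exp (real 9 * 0.1)" by (rule exp_ge_quadratic_power) simp
  finally have "2.45 ^ 17 \<le> exp (0.9::real) ^ 17" by (intro power_mono) auto
  also have "\<dots> = exp 15.3" by (simp flip: exp_of_nat_mult)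
  finally have "2.45 ^ 17 \<le> exp (15.3::real)" .
  moreover have "15000 * 100 / 0.4 \<le> (2.45::real) ^ 17" by (simp add: power_divide)
  ultimately have "15000 * 100 / 0.4 \<le> exp (15.3::real)" by linarith
  then have base: "15000 * 100 * exp (- 15.3) \<le> (0.4::real)" by (simp add: exp_minus field_simps)
  have "200 \<le> (1 + 0.5 + 0.5\<^sup>2 / 2 :: real) ^ 16" by (simp add: power2_eq_square power_divide)
  also have "\<dots> \<le> exp (real 16 * 0.5)" by (rule exp_ge_quadratic_power) simp
  finally have "200 \<le> exp (8::real)" by simp
  then have ratio: "100 * exp (- 8) \<le> (1/2::real)" by (simp add: exp_minus field_simps)
  have "1 + real k * (9/16) \<le> (1 + 9/16) ^ k" by (rule Bernoulli_inequality) simp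
  then have "- 15.3 * (25/16) ^ k \<le> - 15.3 + real k * (- 8)" by simp
  then have "exp (- 15.3 * (25/16) ^ k) \<le> exp (- 15.3 + real k * (- 8))" by (subst exp_le_cancel_iff)
  also have "\<dots> = exp (- 15.3) * exp (- 8) ^ k" by (simp only: exp_add exp_of_nat_mult)
  finally have "15000 * 100 ^ Suc k * exp (- 15.3 * (25/16) ^ k) \<le> (15000::real) * 100 ^ Suc k * (exp (- 15.3) * exp (- 8) ^ k)"
    by (intro mult_left_mono) auto
  also have "\<dots> = (15000 * 100 * exp (- 15.3)) * (100 * exp (- 8)) ^ k" by (simp add: power_mult_distrib)
  also have "\<dots> \<le> 0.4 * (1/2) ^ k" using base ratio by (intro mult_mono power_mono) auto
  finally show ?thesis .
qed

text \<open>
  The number of levels depends on \<open>\<sigma>\<close>. As the chain did not stop at level \<open>k\<close>, the precision \<open>\<delta> k\<close> is not too small compared with \<open>\<sigma>\<close>;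
  this is exactly what the condition \<open>t (Suc k) \<le> 2 * \<delta> k\<close> of the chaining bound asks for.
\<close>

lemma min_star_discrepancy_dim_ge_2:
  assumes d: "2 \<le> d" and n: "1 \<le> n"
  shows "min_star_discrepancy n d \<le> 2.3463 * sqrt (real d / real n)"
proof -
  define \<sigma> where "\<sigma> = sqrt (real d / real n)"
  have \<sigma>: "0 < \<sigma>" "real n * \<sigma>\<^sup>2 = real d" using d n by (auto simp: \<sigma>_def)
  define \<delta> :: "nat \<Rightarrow> real" where "\<delta> k = 1 / (5000 * 100 ^ k)" for k
  define t where "t k = (case k of 0 \<Rightarrow> 2.2 * \<sigma> | Suc j \<Rightarrow> 0.1107 * \<sigma> / 8 ^ j)" for k
  \<comment> \<open>the part of \<open>2.3463\<close> left for the final rounding: \<open>2.3463 - 2.2\<close> for a single level, and \<open>2.3463 - 2.2 - 0.1107 * 8/7\<close> rounded down otherwise\<close>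
  define z :: "nat \<Rightarrow> real" where "z k = (if k = 0 then 0.1463 else 0.0197)" for k
  define stop where "stop k \<longleftrightarrow> 2 * \<delta> k \<le> z k * \<sigma>" for k
  have "\<exists>k. stop k"
  proof -
    obtain k where k: "1 / \<sigma> < 100 ^ k" using real_arch_pow[of 100 "1/\<sigma>"] by auto
    have "2 * \<delta> (Suc k) \<le> z (Suc k) * \<sigma>"
      using k \<sigma>(1) by (simp add: \<delta>_def z_def field_simps)
    then show ?thesis unfolding stop_def by blast
  qed
  then obtain K where K: "stop K" and before: "\<And>k. k < K \<Longrightarrow> \<not> stop k"
    using exists_least_iff[of stop] by blast
  have "min_star_discrepancy n d \<le> (\<Sum>k\<le>K. t k) + 2 * \<delta> K"
  proof (rule min_star_discrepancy_chaining[OF d n])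
    show "0 < \<delta> k" for k by (simp add: \<delta>_def)
    show "\<delta> k \<le> 1/5000" for k by (simp add: \<delta>_def field_simps)
    show "0 < t k" for k using \<sigma> by (simp add: t_def split: nat.split)
    show "t (Suc k) \<le> 2 * \<delta> k" if "k < K" for k
    proof -
      have "t (Suc k) \<le> z k * \<sigma>"
      proof (cases k)
        case 0
        then show ?thesis using \<sigma> by (simp add: t_def z_def)
      next
        case (Suc j)
        have "0.1107 / 8 ^ Suc j \<le> (0.1107 / 8 :: real)" by (simp add: field_simps)
        then have "0.1107 / 8 ^ Suc j \<le> (0.0197 :: real)" by simp
        then have "0.1107 / 8 ^ Suc j * \<sigma> \<le> 0.0197 * \<sigma>" using \<sigma> by (intro mult_right_mono) auto
        then show ?thesis using Suc by (simp add: t_def z_def)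
      qed
      then show ?thesis using before[OF that] by (simp add: stop_def)
    qed
    have "4/5 * (3 / \<delta> 0) ^ d * exp (- 2 * real n * (t 0)\<^sup>2) = 4/5 * (15000 * exp (- 9.68)) ^ d"
    proof -
      have "- 2 * real n * (t 0)\<^sup>2 = - 9.68 * (real n * \<sigma>\<^sup>2)" by (simp add: t_def power2_eq_square)
      then show ?thesis unfolding \<sigma>(2)
        by (simp add: \<delta>_def power_mult_distrib exp_of_nat_mult[symmetric] mult.commute)
    qed
    also have "\<dots> \<le> 4/5 * 0.95 ^ d"
      using level_zero_failure by (intro mult_left_mono power_mono) auto
    also have "\<dots> \<le> 4/5 * 0.95 ^ 2" using d by (intro mult_left_mono power_decreasing) auto
    finally have level0: "4/5 * (3 / \<delta> 0) ^ d * exp (- 2 * real n * (t 0)\<^sup>2) \<le> 4/5 * 0.95 ^ 2" .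
    have level_Suc: "4/5 * (3 / \<delta> (Suc k)) ^ d * exp (- real n * (t (Suc k))\<^sup>2 / (4 * \<delta> k)) \<le> 4/5 * 0.16 * (1/4) ^ k" for k
    proof -
      have "(8 ^ k)\<^sup>2 = (64::real) ^ k" by (simp add: power2_eq_square power_mult_distrib[symmetric])
      then have "- real n * (t (Suc k))\<^sup>2 / (4 * \<delta> k) = - 0.1107\<^sup>2 * 1250 * (100 ^ k / 64 ^ k) * (real n * \<sigma>\<^sup>2)"
        by (simp add: t_def \<delta>_def power_divide power_mult_distrib)
      also have "\<dots> = - (0.1107\<^sup>2 * 1250) * ((25/16) ^ k * real d)"
        unfolding \<sigma>(2) by (simp add: power_divide[symmetric])
      also have "\<dots> \<le> - 15.3 * ((25/16) ^ k * real d)"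
        by (intro mult_right_mono) (auto simp: power2_eq_square)
      finally have "exp (- real n * (t (Suc k))\<^sup>2 / (4 * \<delta> k)) \<le> exp (real d * (- 15.3 * (25/16) ^ k))"
        by (simp add: mult_ac)
      then have "4/5 * (3 / \<delta> (Suc k)) ^ d * exp (- real n * (t (Suc k))\<^sup>2 / (4 * \<delta> k)) \<le>
          4/5 * (15000 * 100 ^ Suc k) ^ d * exp (- 15.3 * (25/16) ^ k) ^ d"
        unfolding exp_of_nat_mult by (intro mult_mono) (auto simp: \<delta>_def)
      also have "\<dots> = 4/5 * (15000 * 100 ^ Suc k * exp (- 15.3 * (25/16) ^ k)) ^ d"
        by (simp only: power_mult_distrib mult.assoc)
      also have "\<dots> \<le> 4/5 * (0.4 * (1/2) ^ k) ^ d"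
        using level_Suc_failure[of k] by (intro mult_left_mono power_mono) auto
      also have "\<dots> \<le> 4/5 * (0.4 * (1/2) ^ k) ^ 2"
        using d power_le_one[of "1/2::real" k] by (intro mult_left_mono power_decreasing) auto
      also have "\<dots> = 4/5 * 0.16 * (1/4) ^ k"
        by (simp add: power2_eq_square power_mult_distrib power_divide flip: power_mult_distrib)
      finally show ?thesis .
    qed
    have "(\<Sum>k<K. 4/5 * (3 / \<delta> (Suc k)) ^ d * exp (- real n * (t (Suc k))\<^sup>2 / (4 * \<delta> k))) \<le>
        (\<Sum>k<K. 4/5 * 0.16 * (1/4) ^ k)"
      by (intro sum_mono level_Suc)
    also have "\<dots> \<le> 4/5 * 0.16 * (1 / (1 - 1/4))"
      unfolding sum_distrib_left[symmetric] by (intro mult_left_mono sum_geometric_le) auto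
    finally show "4/5 * (3 / \<delta> 0) ^ d * exp (- 2 * real n * (t 0)\<^sup>2) +
       (\<Sum>k<K. 4/5 * (3 / \<delta> (Suc k)) ^ d * exp (- real n * (t (Suc k))\<^sup>2 / (4 * \<delta> k))) \<le> 1"
      using level0 by (simp add: power2_eq_square)
  qed
  also have "\<dots> \<le> 2.3463 * \<sigma>"
  proof (cases K)
    case 0
    then show ?thesis using K by (simp add: stop_def t_def z_def)
  next
    case (Suc j)
    have "(\<Sum>k\<le>K. t k) = 2.2 * \<sigma> + (\<Sum>k<K. 0.1107 * \<sigma> * (1/8) ^ k)"
      unfolding lessThan_Suc_atMost[symmetric] sum.lessThan_Suc_shift by (simp add: t_def power_divide)
    also have "(\<Sum>k<K. 0.1107 * \<sigma> * (1/8) ^ k) \<le> 0.1107 * \<sigma> * (1 / (1 - 1/8))"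
      unfolding sum_distrib_left[symmetric] using \<sigma> by (intro mult_left_mono sum_geometric_le) auto
    finally show ?thesis using K Suc \<sigma>(1) by (simp add: stop_def z_def)
  qed
  finally show ?thesis by (simp add: \<sigma>_def)
qed

section \<open>The discrepancy bounds\<close>

lemma min_star_discrepancy_dim_1:
  assumes n: "1 \<le> n"
  shows "min_star_discrepancy n 1 \<le> 1 / real n"
proof -
  define f where "f i = (\<lambda>j\<in>{..<1::nat}. real i / real n)" for i :: nat
  have inj: "inj_on f {..<n}"
  proof (rule inj_onI)
    fix i k assume "f i = f k"
    then have "f i 0 = f k 0" by simp
    then show "i = k" using n by (simp add: f_def)
  qed
  have card: "card (f ` {..<n}) = n" using inj by (simp add: card_image)
  show ?thesis
  proof (rule min_star_discrepancy_leI)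
    show "f ` {..<n} \<in> point_sets n 1"
      using card by (auto simp: point_sets_def f_def PiE_iff split: if_splits)
    fix x :: "nat \<Rightarrow> real" assume "x \<in> {..<1} \<rightarrow>\<^sub>E {0..1}"
    then have x: "0 \<le> x 0" "x 0 \<le> 1" by (auto simp: PiE_iff)
    \<comment> \<open>the number of the points \<open>i/n\<close> in the box\<close>
    define c where "c = nat \<lceil>real n * x 0\<rceil>"
    have nx: "0 \<le> real n * x 0" "real n * x 0 \<le> real n" using x n by (auto simp: mult_le_cancel_left1)
    then have "\<lceil>real n * x 0\<rceil> \<le> int n" by (simp add: ceiling_le_iff)
    then have cn: "c \<le> n" unfolding c_def by linarith
    have in_box: "f i \<in> anchored_box 1 x \<longleftrightarrow> i < c" for i
    proof -
      have "f i \<in> anchored_box 1 x \<longleftrightarrow> real i / real n < x 0"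
        by (auto simp: anchored_box_def f_def PiE_iff)
      also have "\<dots> \<longleftrightarrow> real i < real n * x 0" using n by (simp add: field_simps)
      also have "\<dots> \<longleftrightarrow> i < c" using nx unfolding c_def by linarith
      finally show ?thesis .
    qed
    have "(\<Sum>p\<in>f ` {..<n}. indicator (anchored_box 1 x) p :: real) = (\<Sum>i<n. indicator {..<c} i)"
      unfolding sum.reindex[OF inj] comp_def by (simp only: indicator_def in_box lessThan_iff)
    also have "\<dots> = (\<Sum>i<c. 1)" using cn by (intro sum.mono_neutral_cong_right) auto
    also have "\<dots> = real c" by simp
    finally have "local_discrepancy 1 (f ` {..<n}) x = real c / real n - x 0"
      unfolding local_discrepancy_def card by (simp add: box_volume_def)
    also have "\<dots> = (real c - real n * x 0) / real n" using n by (simp add: field_simps)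
    finally have eq: "local_discrepancy 1 (f ` {..<n}) x = (real c - real n * x 0) / real n" .
    have "\<bar>real c - real n * x 0\<bar> \<le> 1" using nx unfolding c_def by linarith
    then show "\<bar>local_discrepancy 1 (f ` {..<n}) x\<bar> \<le> 1 / real n"
      unfolding eq abs_divide by (intro frac_le) (use n in auto)
  qed
qed

lemma min_star_discrepancy_le:
  assumes "1 \<le> d" "1 \<le> n"
  shows "min_star_discrepancy n d \<le> 2.3463 * sqrt (real d / real n)"
proof (cases "d = 1")
  case True
  have "1 \<le> sqrt (real n)" using assms by simp
  then have "1 / real n \<le> 1 / sqrt (real n)"
    using assms real_sqrt_le_mono[of "real n" "real n * real n"] by (intro divide_left_mono) auto
  also have "\<dots> \<le> 2.3463 * sqrt (real d / real n)"
    using assms True by (simp add: real_sqrt_divide field_simps)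
  finally show ?thesis
    using min_star_discrepancy_dim_1[OF assms(2)] True by simp
next
  case False
  then show ?thesis using assms by (intro min_star_discrepancy_dim_ge_2) auto
qed

theorem theorem1p4:
  "(\<forall>d n :: nat. 1 \<le> d \<longrightarrow> 1 \<le> n \<longrightarrow>
      min_star_discrepancy n d \<le> 2.3463 * sqrt (real d / real n)) \<and>
   (\<forall>(d :: nat) (\<epsilon> :: real). 1 \<le> d \<longrightarrow> 0 < \<epsilon> \<longrightarrow> \<epsilon> < 1 \<longrightarrow>
      int (inverse_star_discrepancy d \<epsilon>) \<le> \<lceil>5.5052 * real d * \<epsilon> powi (-2)\<rceil>)"
proof (rule conjI; intro allI impI)
  fix d n :: nat
  assume "1 \<le> d" "1 \<le> n"
  then show "min_star_discrepancy n d \<le> 2.3463 * sqrt (real d / real n)"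
    by (rule min_star_discrepancy_le)
next
  fix d :: nat and \<epsilon> :: real
  assume d: "1 \<le> d" and \<epsilon>: "0 < \<epsilon>" "\<epsilon> < 1"
  define r where "r = 5.5052 * real d * \<epsilon> powi (-2)"
  have "\<epsilon> powi (-2) = 1 / \<epsilon>\<^sup>2" by (simp add: power_int_def field_simps)
  then have r: "r = 5.5052 * real d / \<epsilon>\<^sup>2" by (simp add: r_def)
  have r0: "0 < r" using d \<epsilon> by (simp add: r)
  define n where "n = nat \<lceil>r\<rceil>"
  have n: "1 \<le> n" "r \<le> real n" using r0 unfolding n_def by linarith+
  have "2.3463 * sqrt (real d / real n) \<le> \<epsilon>"
  proof (rule power2_le_imp_le)
    have "(2.3463 * sqrt (real d / real n))\<^sup>2 = 2.3463\<^sup>2 * (real d / real n)"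
      unfolding power_mult_distrib by simp
    also have "\<dots> \<le> 5.5052 * (real d / real n)" by (intro mult_right_mono) (auto simp: power2_eq_square)
    also have "\<dots> \<le> 5.5052 * (real d / r)" using n r0 by (intro mult_left_mono divide_left_mono) auto
    also have "\<dots> = \<epsilon>\<^sup>2" using d \<epsilon> by (simp add: r)
    finally show "(2.3463 * sqrt (real d / real n))\<^sup>2 \<le> \<epsilon>\<^sup>2" .
  qed (use \<epsilon> in simp)
  then have "min_star_discrepancy n d \<le> \<epsilon>"
    using min_star_discrepancy_le[OF d n(1)] by linarith
  then have "inverse_star_discrepancy d \<epsilon> \<le> n"
    unfolding inverse_star_discrepancy_def using n(1) by (intro Least_le) simp
  then have "int (inverse_star_discrepancy d \<epsilon>) \<le> \<lceil>r\<rceil>" using r0 unfolding n_def by linarith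
  then show "int (inverse_star_discrepancy d \<epsilon>) \<le> \<lceil>5.5052 * real d * \<epsilon> powi (-2)\<rceil>"
    by (simp only: r_def)
qed

end
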